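(* Let $\mu$ be a non-atomic self-similar measure supported on a closed interval $J\subseteq\mathbb{R}$, and let $0<\alpha\le1$ and $0<\delta\le 1$. Then there exists a constant $\tau=\tau(\mu,\delta,\alpha)>0$, depending only on $\mu,\delta,\alpha$, such that the following holds. Let $g\in C^{1+\alpha}(J)$ be real-valued and suppose that $g'$ is $\delta$-non-flat on $J$. Then there exists a constant $C=C(g)>0$ such that $$\left|\int e^{2\pi i g(x)\lambda}\,d\mu(x)\right|\le C\,\lambda^{-\tau}\quad\text{for all }\lambda>0.$$
   Context: Self-similar measures: a self-similar IFS is a finite set $\Phi=\{f_1,\dots,f_n\}$ of maps $f_i(x)=r_i x+t_i$ with $r_i\in(-1,1)\setminus\{0\}$, $t_i\in\mathbb{R}$, each mapping some fixed compact interval into itself; it is assumed that some two of the maps have different fixed points. Given a probability vector $(p_1,\dots,p_n)$ with all $p_i>0$, the self-similar measure is the unique Borel probability measure $\mu$ on $\mathbb{R}$ with $\mu=\sum_i p_i\,f_i\mu$ ($f_i\mu$ is the push-forward). $C^{1+\alpha}(J)$ is the space of differentiable functions on $J$ whose derivative is $\alpha$-Hölder continuous (Lipschitz if $\alpha=1$). Non-flatness: for bounded $A\subseteq\mathbb{R}$ and $r>0$ let $\mathcal{N}_r(A)$ be the minimal number of balls of diameter $r$ needed to cover $A$. For $0<\delta\le1$, a real-valued function $h$ is called $\delta$-non-flat on an interval $J$ if for every $\epsilon>0$ there exists $n_0=n_0(\epsilon)\ge1$ such that for all $n>n_0$ and every bounded subset $A\subset J$: if $\mathcal{N}_{2^{-\delta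 n}}(A)\ge 2^{\epsilon n}$ then $\operatorname{diam}(h(A))\ge 2^{-n}$. The constant $C$ may depend on $g$ (and on the fixed data $\mu,\delta,\alpha$), while $\tau$ is uniform over all such $g$. *)

theory Defs
  imports "HOL-Probability.Probability"
begin

text \<open>The maps are \<open>f\<^sub>i(x) = r i * x + t i\<close> for \<open>i < n\<close>.\<close>

definition self_similar_ifs :: "nat \<Rightarrow> (nat \<Rightarrow> real) \<Rightarrow> (nat \<Rightarrow> real) \<Rightarrow> bool" where
  "self_similar_ifs n r t \<longleftrightarrow>
     (\<forall>i<n. r i \<in> {-1<..<1} - {0}) \<and>
     (\<exists>a b. a \<le> b \<and> (\<forall>i<n. (\<lambda>x. r i * x + t i) ` {a..b} \<subseteq> {a..b})) \<and>
     (\<exists>i<n. \<exists>j<n. \<exists>x y. r i * x + t i = x \<and> r j * y + t j = y \<and> x \<noteq> y)"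

text \<open>By Hutchinson's theorem, for each such IFS and positive probability vector exactly one
  Borel probability measure satisfies the last conjunct.\<close>

definition self_similar_measure :: "real measure \<Rightarrow> bool" where
  "self_similar_measure \<mu> \<longleftrightarrow>
     prob_space \<mu> \<and> sets \<mu> = sets borel \<and>
     (\<exists>n r t p. self_similar_ifs n r t \<and>
        (\<forall>i<n. p i > 0) \<and> (\<Sum>i<n. p i) = 1 \<and>
        (\<forall>A\<in>sets borel.
           measure \<mu> A = (\<Sum>i<n. p i * measure (distr \<mu> borel (\<lambda>x. r i * x + t i)) A)))"

definition non_atomic :: "real measure \<Rightarrow> bool" where
  "non_atomic \<mu> \<longleftrightarrow> (\<forall>x. measure \<mu> {x} = 0)"

definition holder_on :: "real \<Rightarrow> real set \<Rightarrow> (real \<Rightarrow> real) \<Rightarrow> bool" where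
  "holder_on \<alpha> J h \<longleftrightarrow> (\<exists>L. \<forall>x\<in>J. \<forall>y\<in>J. \<bar>h x - h y\<bar> \<le> L * \<bar>x - y\<bar> powr \<alpha>)"

text \<open>The derivative relative to \<open>J\<close>, hence one-sided at the endpoints. It is uniquely determined
  only if \<open>J\<close> is a nondegenerate interval.\<close>

definition deriv_within :: "real set \<Rightarrow> (real \<Rightarrow> real) \<Rightarrow> real \<Rightarrow> real" where
  "deriv_within J g x = vector_derivative g (at x within J)"

definition C1_holder :: "real \<Rightarrow> real set \<Rightarrow> (real \<Rightarrow> real) set" where
  "C1_holder \<alpha> J = {g. g differentiable_on J \<and> holder_on \<alpha> J (deriv_within J g)}"

text \<open>Only meaningful for bounded \<open>A\<close> and \<open>r > 0\<close>, where finite covers exist.\<close>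

definition covering_number :: "real \<Rightarrow> real set \<Rightarrow> nat" where
  "covering_number r A = (LEAST k. \<exists>F. finite F \<and> card F = k \<and> A \<subseteq> (\<Union>c\<in>F. ball c (r / 2)))"

text \<open>The guard on \<open>h ` A\<close> encodes that an unbounded set has infinite diameter, since the
  real-valued \<^const>\<open>diameter\<close> is unspecified there.\<close>

definition non_flat :: "real \<Rightarrow> (real \<Rightarrow> real) \<Rightarrow> real set \<Rightarrow> bool" where
  "non_flat \<delta> h J \<longleftrightarrow>
     (\<forall>\<epsilon>>0. \<exists>n0::nat. n0 \<ge> 1 \<and>
        (\<forall>n>n0. \<forall>A. bounded A \<and> A \<subseteq> J \<longrightarrow>
           real (covering_number (2 powr (- \<delta> * real n)) A) \<ge> 2 powr (\<epsilon> * real n) \<longrightarrow>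
           (bounded (h ` A) \<longrightarrow> diameter (h ` A) \<ge> 2 powr (- real n))))"

end

theory Submission
  imports Defs
begin

text \<open>Write \<open>F s\<close> for the modulus of the Fourier transform of \<open>\<mu>\<close>. Merging the two words \<open>ab\<close> and \<open>ba\<close>, where
  the maps \<open>f a\<close> and \<open>f b\<close> have different fixed points, bounds \<open>F s\<close> by an average of the values
  \<open>F (\<rho> u * s)\<close> in which one term carries a factor \<open>\<bar>cos (D * s)\<bar>\<close>. By Minkowski's inequality the
  \<open>p\<close>-th power sum of \<open>F\<close> over separated points of \<open>{-T..T}\<close> is then \<open>O(T\<^sup>\<beta>)\<close>, with \<open>\<beta>\<close> as small as
  desired if \<open>p\<close> is large; this quantitative flattening replaces Tsujii's large deviation theorem
  for the Fourier transform.

  Decompose \<open>\<mu>\<close> into copies of size about \<open>l powr - \<kappa>\<close> with \<open>1 / (1 + \<alpha>) < \<kappa> < 1\<close>, and linearize \<open>g\<close>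
  on each of them up to a phase error \<open>O(l powr - (\<alpha> / 2))\<close>. What remains is an average of \<open>F\<close> at the frequencies
  \<open>2 * pi * l * g' y * r\<close>, where \<open>r\<close> takes only polylogarithmically many values. Non-flatness of \<open>g'\<close>
  and the Frostman property of \<open>\<mu>\<close> bound the mass of the copies whose frequency lies in a given unit
  cell, and Jensen's inequality together with flattening concludes.\<close>

section \<open>Separated sets and power sums\<close>

text \<open>The obstacle is separation. Dilating a set of frequencies by \<open>\<rho> u\<close>
  brings its points closer together, and returning to the original separation by colouring costs a
  factor \<open>N\<close>; paid in every step, it would force an exponent \<open>\<beta>\<close>
  that cannot be made small. Two devices prevent this. In the branch with the cosine, points where
  the cosine has modulus close to 1 lie near a lattice and stay separated, while at all others a
  high power of the cosine outweighs \<open>N\<close>. In the remaining branches the loss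
  accumulates over \<open>L\<close> steps to an \<open>N\<close> of order
  \<open>(1 / m) ^ L\<close>, but Minkowski averages \<open>p\<close>-th roots, so the logarithm of
  the growth receives only a term of order \<open>(1 - w u0) ^ L * ln N\<close>. This tends to 0,
  because \<open>ln N\<close> is linear in \<open>L\<close>.

  Flattening says only that few frequencies are bad; non-flatness of \<open>g'\<close> keeps the
  copies from concentrating on them. The copies are grouped by contraction ratio, since otherwise a
  frequency would not determine the value of \<open>g'\<close>.\<close>

lemma convex_on_power_nonneg: "convex_on {0::real..} (\<lambda>x. x ^ p)"
proof (cases "even p")
  case True
  then show ?thesis
    using convex_on_subset[OF convex_power_even] by auto
qed (rule convex_power_odd)

lemma jensen_power:
  fixes w x :: "'a \<Rightarrow> real"
  assumes "finite U" "(\<Sum>u\<in>U. w u) = 1" "\<And>u. u \<in> U \<Longrightarrow> 0 \<le> w u" "\<And>u. u \<in> U \<Longrightarrow> 0 \<le> x u"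
  shows "(\<Sum>u\<in>U. w u * x u) ^ p \<le> (\<Sum>u\<in>U. w u * x u ^ p)"
proof -
  have "U \<noteq> {}" using assms(2) by auto
  then show ?thesis
    using convex_on_sum[OF assms(1) _ convex_on_power_nonneg assms(2), of x p] assms(3,4) by simp
qed

text \<open>Jensen with weights proportional to \<open>w u * a u\<close>, applied to the normalized
  functions \<open>G u x / a u\<close>. This is Minkowski's inequality for the \<open>p\<close>-norm
  on \<open>X\<close>, kept free of \<open>p\<close>-th roots by entering the norms as bounds
  \<open>a u\<close>.\<close>

lemma minkowski_weighted:
  fixes w a :: "'u \<Rightarrow> real" and G :: "'u \<Rightarrow> 'x \<Rightarrow> real"
  assumes U: "finite U" "(\<Sum>u\<in>U. w u) = 1" "\<And>u. u \<in> U \<Longrightarrow> 0 \<le> w u"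
    and a: "\<And>u. u \<in> U \<Longrightarrow> 0 < a u"
    and G: "\<And>u x. u \<in> U \<Longrightarrow> x \<in> X \<Longrightarrow> 0 \<le> G u x"
    and bound: "\<And>u. u \<in> U \<Longrightarrow> (\<Sum>x\<in>X. G u x ^ p) \<le> a u ^ p"
  shows "(\<Sum>x\<in>X. (\<Sum>u\<in>U. w u * G u x) ^ p) \<le> (\<Sum>u\<in>U. w u * a u) ^ p"
proof -
  define S where "S = (\<Sum>u\<in>U. w u * a u)"
  define v where "v u = w u * a u / S" for u
  have "S > 0"
  proof -
    obtain u where u: "u \<in> U" "w u \<noteq> 0" using U(2) by (metis sum.neutral zero_neq_one)
    show ?thesis unfolding S_def
      using u U a by (intro sum_pos2[of _ u]) (auto intro!: mult_pos_pos mult_nonneg_nonneg simp: less_le)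
  qed
  have v: "(\<Sum>u\<in>U. v u) = 1" "\<And>u. u \<in> U \<Longrightarrow> 0 \<le> v u"
    using \<open>S > 0\<close> U a by (auto simp: v_def S_def less_imp_le simp flip: sum_divide_distrib)
  have "(\<Sum>x\<in>X. (\<Sum>u\<in>U. w u * G u x) ^ p) \<le> (\<Sum>x\<in>X. S ^ p * (\<Sum>u\<in>U. v u * (G u x / a u) ^ p))"
  proof (rule sum_mono)
    fix x assume x: "x \<in> X"
    have "(\<Sum>u\<in>U. w u * G u x) = S * (\<Sum>u\<in>U. v u * (G u x / a u))"
      unfolding sum_distrib_left
    proof (rule sum.cong)
      fix u assume "u \<in> U"
      with a[of u] \<open>S > 0\<close> show "w u * G u x = S * (v u * (G u x / a u))" by (simp add: v_def)
    qed simp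
    also have "\<dots> ^ p \<le> S ^ p * (\<Sum>u\<in>U. v u * (G u x / a u) ^ p)"
      unfolding power_mult_distrib using \<open>S > 0\<close> v U(1) G[OF _ x] a
      by (intro mult_left_mono jensen_power) (auto intro!: divide_nonneg_pos)
    finally show "(\<Sum>u\<in>U. w u * G u x) ^ p \<le> S ^ p * (\<Sum>u\<in>U. v u * (G u x / a u) ^ p)" .
  qed
  also have "\<dots> = S ^ p * (\<Sum>u\<in>U. v u * ((\<Sum>x\<in>X. G u x ^ p) / a u ^ p))"
    by (subst sum_distrib_left[symmetric], subst sum.swap)
      (simp add: power_divide sum_divide_distrib sum_distrib_left)
  also have "\<dots> \<le> S ^ p * (\<Sum>u\<in>U. v u * 1)"
  proof (intro mult_left_mono sum_mono)
    fix u assume u: "u \<in> U"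
    show "(\<Sum>x\<in>X. G u x ^ p) / a u ^ p \<le> 1" using bound[OF u] a[OF u] by simp
  qed (use v \<open>S > 0\<close> in auto)
  finally show ?thesis using v by (simp add: S_def)
qed

text \<open>Power sums over arbitrary finite separated sets are a discrete substitute for the
  integral of the \<open>p\<close>-th power, and they apply directly to the irregular frequencies of
  the copies.\<close>

definition separated :: "real \<Rightarrow> real set \<Rightarrow> bool" where
  "separated s X \<longleftrightarrow> (\<forall>x\<in>X. \<forall>y\<in>X. x \<noteq> y \<longrightarrow> s \<le> \<bar>x - y\<bar>)"

lemma separated_image_mult:
  assumes "separated s X" "m \<le> \<bar>c\<bar>" "0 \<le> s"
  shows "separated (m * s) ((*) c ` X)"
proof -
  have "m * s \<le> \<bar>c * x - c * y\<bar>" if "x \<in> X" "y \<in> X" "c * x \<noteq> c * y" for x y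
  proof -
    have "s \<le> \<bar>x - y\<bar>" using assms(1) that by (auto simp: separated_def)
    then have "m * s \<le> \<bar>c\<bar> * \<bar>x - y\<bar>" using assms by (intro mult_mono) auto
    also have "\<dots> = \<bar>c * x - c * y\<bar>" by (simp add: abs_mult flip: right_diff_distrib)
    finally show ?thesis .
  qed
  then show ?thesis unfolding separated_def by blast
qed

lemma separated_floor_diff:
  assumes "separated d Y" "0 < d" "x \<in> Y" "y \<in> Y" "x \<noteq> y"
  shows "\<lfloor>x / d\<rfloor> \<noteq> \<lfloor>y / d\<rfloor>"
proof
  assume "\<lfloor>x / d\<rfloor> = \<lfloor>y / d\<rfloor>"
  then have "\<bar>x / d - y / d\<bar> < 1" by linarith
  then have "\<bar>x - y\<bar> / d < 1" using \<open>0 < d\<close> by (simp add: diff_divide_distrib[symmetric])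
  moreover have "d \<le> \<bar>x - y\<bar>" using assms by (auto simp: separated_def)
  ultimately show False using \<open>0 < d\<close> by simp
qed

text \<open>Distinct floors in one residue class differ by at least \<open>N\<close>, and passing
  from floors back to points loses less than one cell; hence \<open>N - 1\<close>.\<close>

lemma separated_color_class:
  fixes N :: nat
  assumes "0 < d" "s \<le> (real N - 1) * d"
    and inj: "\<And>x y. x \<in> Z \<Longrightarrow> y \<in> Z \<Longrightarrow> x \<noteq> y \<Longrightarrow> \<lfloor>x / d\<rfloor> \<noteq> \<lfloor>y / d\<rfloor>"
    and col: "\<And>x y. x \<in> Z \<Longrightarrow> y \<in> Z \<Longrightarrow> \<lfloor>x / d\<rfloor> mod int N = \<lfloor>y / d\<rfloor> mod int N"
  shows "separated s Z"
  unfolding separated_def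
proof (intro ballI impI)
  fix x y assume xy: "x \<in> Z" "y \<in> Z" "x \<noteq> y"
  have "int N dvd \<lfloor>x / d\<rfloor> - \<lfloor>y / d\<rfloor>" using col[OF xy(1,2)] by (simp add: mod_eq_dvd_iff)
  then have "int N \<le> \<bar>\<lfloor>x / d\<rfloor> - \<lfloor>y / d\<rfloor>\<bar>"
    using inj[OF xy] by (metis abs_of_nat diff_eq_eq dvd_imp_le_int add_0)
  then have "real N \<le> \<bar>real_of_int \<lfloor>x / d\<rfloor> - real_of_int \<lfloor>y / d\<rfloor>\<bar>" by linarith
  then have "real N - 1 \<le> \<bar>x / d - y / d\<bar>" by linarith
  also have "\<dots> = \<bar>x - y\<bar> / d" using \<open>0 < d\<close> by (simp add: diff_divide_distrib[symmetric])
  finally have "(real N - 1) * d \<le> \<bar>x - y\<bar>" using \<open>0 < d\<close> by (simp add: field_simps)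
  then show "s \<le> \<bar>x - y\<bar>" using assms(2) by simp
qed

text \<open>Split \<open>Y\<close> into the residue classes of its cells. Only distinctness of the
  cells is assumed, because representatives of neighbouring cells, as in \<open>cell_sum_le\<close>,
  may be arbitrarily close.\<close>

lemma sum_le_of_separated_subsets:
  fixes f :: "real \<Rightarrow> real" and N :: nat
  assumes Y: "finite Y" and d: "0 < d" "s \<le> (real N - 1) * d" and N: "0 < N"
    and inj: "\<And>x y. x \<in> Y \<Longrightarrow> y \<in> Y \<Longrightarrow> x \<noteq> y \<Longrightarrow> \<lfloor>x / d\<rfloor> \<noteq> \<lfloor>y / d\<rfloor>"
    and bound: "\<And>Z. Z \<subseteq> Y \<Longrightarrow> separated s Z \<Longrightarrow> sum f Z \<le> B"
  shows "sum f Y \<le> real N * B"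
proof -
  define col where "col y = \<lfloor>y / d\<rfloor> mod int N" for y
  have im: "col ` Y \<subseteq> {0..<int N}" using N by (auto simp: col_def)
  have "sum f Y = (\<Sum>c\<in>{0..<int N}. sum f {y\<in>Y. col y = c})"
    using sum.group[OF Y _ im, of f] by simp
  also have "\<dots> \<le> (\<Sum>c\<in>{0..<int N}. B)"
  proof (intro sum_mono bound)
    fix c
    show "separated s {y\<in>Y. col y = c}"
      by (rule separated_color_class[OF d]) (use inj in \<open>auto simp: col_def\<close>)
  qed auto
  finally show ?thesis by simp
qed

lemma card_separated_le:
  assumes "finite X" "separated s X" "0 < s" "X \<subseteq> {-1..1}"
  shows "real (card X) \<le> 2 / s + 2"
proof -
  have inj: "inj_on (\<lambda>x. \<lfloor>x / s\<rfloor>) X"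
    using separated_floor_diff[OF assms(2,3)] by (auto simp: inj_on_def)
  have sub: "(\<lambda>x. \<lfloor>x / s\<rfloor>) ` X \<subseteq> {\<lfloor>- 1 / s\<rfloor>..\<lfloor>1 / s\<rfloor>}"
  proof safe
    fix x assume "x \<in> X"
    then have "- 1 \<le> x" "x \<le> 1" using assms(4) by auto
    then have "- 1 / s \<le> x / s" "x / s \<le> 1 / s"
      using assms(3) by (simp_all only: divide_right_mono less_imp_le)
    then show "\<lfloor>x / s\<rfloor> \<in> {\<lfloor>- 1 / s\<rfloor>..\<lfloor>1 / s\<rfloor>}"
      by (simp only: atLeastAtMost_iff floor_mono)
  qed
  have "card X = card ((\<lambda>x. \<lfloor>x / s\<rfloor>) ` X)" using inj by (simp add: card_image)
  also have "\<dots> \<le> card {\<lfloor>- 1 / s\<rfloor>..\<lfloor>1 / s\<rfloor>}" using sub by (intro card_mono) auto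
  also have "\<dots> = nat (\<lfloor>1 / s\<rfloor> - \<lfloor>- 1 / s\<rfloor> + 1)" by simp
  finally have "real (card X) \<le> real_of_int (\<lfloor>1 / s\<rfloor> - \<lfloor>- 1 / s\<rfloor> + 1)"
    using assms(3) by (smt (verit) of_nat_le_iff of_nat_nat of_int_of_nat_eq floor_mono divide_right_mono)
  also have "\<dots> \<le> 2 / s + 2" by (simp add: field_simps) linarith
  finally show ?thesis .
qed

text \<open>The modulus of the cosine has period \<open>pi\<close> and peaks at the multiples of
  \<open>pi\<close>; subtracting the nearest multiple leaves an angle of modulus at most
  \<open>pi / 2\<close>, where the cosine decreases with the modulus.\<close>

lemma abs_cos_le_cos:
  assumes "0 \<le> w" "w \<le> \<bar>t - of_int (round (t / pi)) * pi\<bar>"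
  shows "\<bar>cos t\<bar> \<le> cos w"
proof -
  define k where "k = round (t / pi)"
  define \<theta> where "\<theta> = t - of_int k * pi"
  have "\<bar>t / pi - of_int k\<bar> \<le> 1 / 2" unfolding k_def using of_int_round_abs_le[of "t / pi"] by (simp add: abs_minus_commute)
  moreover have "t / pi - of_int k = \<theta> / pi" by (simp add: \<theta>_def field_simps)
  ultimately have th: "\<bar>\<theta>\<bar> \<le> pi / 2" by (simp add: field_simps)
  have "\<bar>cos t\<bar> = \<bar>cos (\<theta> + of_int k * pi)\<bar>" by (simp add: \<theta>_def)
  also have "\<dots> = \<bar>cos \<theta>\<bar>"
  proof -
    have "sin (of_int k * pi) = 0" by (simp add: sin_zero_iff_int2)
    moreover from this have "\<bar>cos (of_int k * pi)\<bar> = 1"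
      using sin_cos_squared_add[of "of_int k * pi"] by (simp add: abs_square_eq_1)
    ultimately show ?thesis by (simp add: cos_add abs_mult)
  qed
  also have "\<dots> = cos \<bar>\<theta>\<bar>" using th by (simp add: cos_ge_zero)
  also have "\<dots> \<le> cos w" using assms th unfolding \<theta>_def k_def
    by (intro cos_monotone_0_pi_le) auto
  finally show ?thesis .
qed

section \<open>Flattening from a cosine recursion\<close>

lemma convex_comb_pos:
  fixes k a b :: real
  assumes "0 \<le> k" "k \<le> 1" "0 < a" "0 < b"
  shows "0 < (1 - k) * a + k * b"
proof -
  have "min a b \<le> (1 - k) * a + k * b"
    using convex_bound_le[of "- a" "- min a b" "- b" "1 - k" k] assms by simp
  then show ?thesis using assms by simp
qed

lemma exp_le_one_plus_double:
  fixes x :: real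
  assumes "0 \<le> x" "x \<le> 1"
  shows "exp x \<le> 1 + 2 * x"
proof -
  have "x\<^sup>2 \<le> x" using assms by (simp add: power2_eq_square mult_left_le)
  then show ?thesis using exp_bound[OF assms] by simp
qed

text \<open>The properties of the Fourier transform on which flattening rests. The lower bound
  \<open>m\<close> limits how much separation a step can lose; the upper bound \<open>R\<close>
  makes the frequency window shrink.\<close>

locale cos_recursion =
  fixes F :: "real \<Rightarrow> real" and U :: "'u set" and w \<rho> :: "'u \<Rightarrow> real" and u0 :: 'u and D m R :: real
  assumes fin: "finite U" and u0: "u0 \<in> U" and w_sum: "(\<Sum>u\<in>U. w u) = 1"
    and w_nonneg: "\<And>u. u \<in> U \<Longrightarrow> 0 \<le> w u" and w_u0: "0 < w u0"
    and m: "0 < m" "\<And>u. u \<in> U \<Longrightarrow> m \<le> \<bar>\<rho> u\<bar>"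
    and R: "R < 1" "\<And>u. u \<in> U \<Longrightarrow> \<bar>\<rho> u\<bar> \<le> R"
    and D: "0 < D"
    and F_nonneg: "\<And>t. 0 \<le> F t" and F_le_1: "\<And>t. F t \<le> 1"
    and rec: "\<And>t. F t \<le> (\<Sum>u\<in>U. w u * ((if u = u0 then \<bar>cos (D * t)\<bar> else 1) * F (\<rho> u * t)))"
begin

lemma R_pos: "0 < R" and m_less_1: "m < 1"
  using m R u0 by force+

text \<open>The peaks of \<open>\<bar>cos (D * x)\<bar>\<close> are \<open>pi / D\<close> apart.
  Half this spacing, dilated by \<open>\<rho> u0\<close>, is the separation that the special branch
  restores by itself.\<close>

definition sep0 :: real where "sep0 = \<bar>\<rho> u0\<bar> * pi / (2 * D)"

lemma sep0_pos: "0 < sep0"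
  using m u0 D by (force simp: sep0_def)

lemma sum_image_rho:
  assumes "u \<in> U"
  shows "(\<Sum>x\<in>X. F (\<rho> u * x) ^ p) = (\<Sum>y\<in>(*) (\<rho> u) ` X. F y ^ p)"
proof -
  have "\<rho> u \<noteq> 0" using m assms by force
  then show ?thesis by (subst sum.reindex) (auto simp: inj_on_def)
qed

lemma image_rho_subset:
  assumes "u \<in> U" "X \<subseteq> {-T..T}" "R * T \<le> T'"
  shows "(*) (\<rho> u) ` X \<subseteq> {-T'..T'}"
proof safe
  fix x assume "x \<in> X"
  then have "x \<in> {-T..T}" using assms(2) by blast
  then have "\<bar>x\<bar> \<le> T" by auto
  then have "\<bar>\<rho> u * x\<bar> \<le> R * T" unfolding abs_mult
    using R(2)[OF assms(1)] by (intro mult_mono) auto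
  then show "\<rho> u * x \<in> {-T'..T'}" using assms by auto
qed

definition close :: "real \<Rightarrow> real \<Rightarrow> bool" where
  "close \<omega> x \<longleftrightarrow> \<bar>D * x - of_int (round (D * x / pi)) * pi\<bar> \<le> \<omega>"

text \<open>Two points near the same multiple of \<open>pi\<close> would be closer than
  \<open>d\<close>; near different multiples, their multiples by \<open>D\<close> keep a distance of
  \<open>pi - 2 * \<omega>\<close>, hence at least \<open>pi / 2\<close>. The separation obtained
  does not depend on \<open>d\<close>.\<close>

lemma separated_image_close:
  assumes "separated d X" "2 * \<omega> / D < d" "\<omega> \<le> pi / 4"
  shows "separated sep0 ((*) (\<rho> u0) ` {x\<in>X. close \<omega> x})"
  unfolding separated_def
proof (safe)
  fix x y assume x: "x \<in> X" "close \<omega> x" and y: "y \<in> X" "close \<omega> y" and ne: "\<rho> u0 * x \<noteq> \<rho> u0 * y"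
  define k l where "k = round (D * x / pi)" and "l = round (D * y / pi)"
  have k: "\<bar>D * x - of_int k * pi\<bar> \<le> \<omega>" and l: "\<bar>D * y - of_int l * pi\<bar> \<le> \<omega>"
    using x y by (auto simp: close_def k_def l_def)
  have "d \<le> \<bar>x - y\<bar>" using assms(1) x y ne by (auto simp: separated_def)
  with assms(2) have "2 * \<omega> / D < \<bar>x - y\<bar>" by simp
  then have far: "2 * \<omega> < \<bar>D * x - D * y\<bar>"
  proof -
    have "2 * \<omega> < D * \<bar>x - y\<bar>" using \<open>2 * \<omega> / D < \<bar>x - y\<bar>\<close> D by (simp add: field_simps)
    also have "\<dots> = \<bar>D * x - D * y\<bar>" using D by (simp add: abs_mult flip: right_diff_distrib)
    finally show ?thesis .
  qed
  have "k \<noteq> l" using k l far by auto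
  then have "1 \<le> \<bar>real_of_int k - real_of_int l\<bar>" by linarith
  then have "pi \<le> \<bar>of_int k * pi - of_int l * pi\<bar>"
    by (simp add: abs_mult flip: left_diff_distrib)
  then have "pi / 2 \<le> \<bar>D * x - D * y\<bar>" using k l assms(3) by linarith
  then have "pi / 2 \<le> D * \<bar>x - y\<bar>" using D by (simp add: abs_mult flip: right_diff_distrib)
  then have "pi / (2 * D) \<le> \<bar>x - y\<bar>" using D by (simp add: field_simps)
  then have "\<bar>\<rho> u0\<bar> * (pi / (2 * D)) \<le> \<bar>\<rho> u0\<bar> * \<bar>x - y\<bar>" by (intro mult_left_mono) auto
  then show "sep0 \<le> \<bar>\<rho> u0 * x - \<rho> u0 * y\<bar>"
    by (simp add: sep0_def abs_mult flip: right_diff_distrib)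
qed

lemma sum_le_of_sparser:
  assumes "finite Y" "separated d Y" "0 < d" "sep0 \<le> (real N - 1) * d" "Y \<subseteq> {-T..T}"
    and M: "\<And>Y. finite Y \<Longrightarrow> separated sep0 Y \<Longrightarrow> Y \<subseteq> {-T..T} \<Longrightarrow> (\<Sum>y\<in>Y. F y ^ p) \<le> M ^ p"
  shows "(\<Sum>y\<in>Y. F y ^ p) \<le> real N * M ^ p"
proof (rule sum_le_of_separated_subsets[OF assms(1,3,4)])
  show "0 < N" using sep0_pos assms(3,4) by (cases "N = 0") auto
  show "\<lfloor>x / d\<rfloor> \<noteq> \<lfloor>y / d\<rfloor>" if "x \<in> Y" "y \<in> Y" "x \<noteq> y" for x y
    using separated_floor_diff[OF assms(2,3) that] .
  show "(\<Sum>y\<in>Z. F y ^ p) \<le> M ^ p" if "Z \<subseteq> Y" "separated sep0 Z" for Z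
    using that assms(1,5) by (intro M) (auto intro: finite_subset)
qed

text \<open>Points of \<open>X\<close> close to a zero of \<open>sin (D * x)\<close> lose no separation under \<open>\<rho> u0\<close>: there is at
  most one of them per zero. The others gain the factor \<open>cos \<omega>\<close>.\<close>

lemma special_term:
  assumes X: "finite X" "separated d X" "X \<subseteq> {-T..T}" "R * T \<le> T'"
    and \<omega>: "0 < \<omega>" "2 * \<omega> / D < d" "\<omega> \<le> pi / 4"
    and N: "sep0 \<le> (real N - 1) * (m * d)"
    and M: "\<And>Y. finite Y \<Longrightarrow> separated sep0 Y \<Longrightarrow> Y \<subseteq> {-T'..T'} \<Longrightarrow> (\<Sum>y\<in>Y. F y ^ p) \<le> M ^ p" "0 < M"
    and E: "1 + real N * cos \<omega> ^ p \<le> E ^ p"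
  shows "(\<Sum>x\<in>X. (\<bar>cos (D * x)\<bar> * F (\<rho> u0 * x)) ^ p) \<le> (E * M) ^ p"
proof -
  have d: "0 < d" using \<omega> D by (meson divide_pos_pos less_trans mult_pos_pos zero_less_numeral)
  let ?c = "close \<omega>" and ?G = "\<lambda>x. (\<bar>cos (D * x)\<bar> * F (\<rho> u0 * x)) ^ p"
  have cw: "0 \<le> cos \<omega>" using \<omega> by (intro cos_ge_zero) auto
  note im = image_rho_subset[OF u0 X(3,4)]
  have "sum ?G X = sum ?G {x\<in>X. ?c x} + sum ?G {x\<in>X. \<not> ?c x}"
    using X(1) by (subst sum.union_disjoint[symmetric]) (auto intro: sum.cong)
  also have "sum ?G {x\<in>X. ?c x} \<le> (\<Sum>x\<in>{x\<in>X. ?c x}. F (\<rho> u0 * x) ^ p)"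
    by (intro sum_mono power_mono mult_left_le_one_le) (auto simp: F_nonneg)
  also have "\<dots> \<le> M ^ p" unfolding sum_image_rho[OF u0]
    using im X(1) separated_image_close[OF X(2) \<omega>(2,3)] by (intro M) auto
  also have "sum ?G {x\<in>X. \<not> ?c x} \<le> (\<Sum>x\<in>{x\<in>X. \<not> ?c x}. cos \<omega> ^ p * F (\<rho> u0 * x) ^ p)"
    unfolding power_mult_distrib[symmetric]
    using \<omega>(1) by (intro sum_mono power_mono mult_right_mono abs_cos_le_cos)
      (auto simp: F_nonneg close_def)
  also have "\<dots> \<le> (\<Sum>x\<in>X. cos \<omega> ^ p * F (\<rho> u0 * x) ^ p)"
    using X(1) cw F_nonneg by (intro sum_mono2) auto
  also have "\<dots> = cos \<omega> ^ p * (\<Sum>y\<in>(*) (\<rho> u0) ` X. F y ^ p)"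
    by (simp add: sum_image_rho[OF u0, symmetric] sum_distrib_left)
  \<comment> \<open>These points have dropped to separation \<open>m * d\<close>; the price
    \<open>N\<close> of colouring is to be absorbed by \<open>cos \<omega> ^ p\<close>.\<close>
  also have "\<dots> \<le> cos \<omega> ^ p * (real N * M ^ p)"
    using X(1) im N d m separated_image_mult[OF X(2) m(2)[OF u0]] cw
    by (intro mult_left_mono sum_le_of_sparser[where d = "m * d" and T = T'] M) auto
  finally have "sum ?G X \<le> (1 + real N * cos \<omega> ^ p) * M ^ p" by (simp add: algebra_simps)
  also have "\<dots> \<le> E ^ p * M ^ p" using E M(2) by (intro mult_right_mono) auto
  finally show ?thesis by (simp add: power_mult_distrib)
qed

text \<open>Minkowski combines the branches: the special one is back at separation
  \<open>sep0\<close> with factor \<open>E\<close>, the others sit at \<open>m * d\<close> with a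
  bound \<open>B\<close> supplied by the next step, and each enters only with its weight.\<close>

lemma step:
  assumes X: "finite X" "separated d X" "X \<subseteq> {-T..T}" "R * T \<le> T'"
    and \<omega>: "0 < \<omega>" "2 * \<omega> / D < d" "\<omega> \<le> pi / 4"
    and N: "sep0 \<le> (real N - 1) * (m * d)"
    and M: "\<And>Y. finite Y \<Longrightarrow> separated sep0 Y \<Longrightarrow> Y \<subseteq> {-T'..T'} \<Longrightarrow> (\<Sum>y\<in>Y. F y ^ p) \<le> M ^ p" "0 < M"
    and E: "1 + real N * cos \<omega> ^ p \<le> E ^ p" "0 < E"
    and B: "\<And>Y. finite Y \<Longrightarrow> separated (m * d) Y \<Longrightarrow> Y \<subseteq> {-(R * T)..R * T} \<Longrightarrow> (\<Sum>y\<in>Y. F y ^ p) \<le> B ^ p" "0 < B"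
  shows "(\<Sum>x\<in>X. F x ^ p) \<le> (w u0 * (E * M) + (1 - w u0) * B) ^ p"
proof -
  define G where "G u x = (if u = u0 then \<bar>cos (D * x)\<bar> else 1) * F (\<rho> u * x)" for u x
  define a where "a u = (if u = u0 then E * M else B)" for u
  have d: "0 < d" using \<omega> D by (meson divide_pos_pos less_trans mult_pos_pos zero_less_numeral)
  have "(\<Sum>x\<in>X. F x ^ p) \<le> (\<Sum>x\<in>X. (\<Sum>u\<in>U. w u * G u x) ^ p)"
    using rec by (intro sum_mono power_mono F_nonneg) (auto simp: G_def)
  also have "\<dots> \<le> (\<Sum>u\<in>U. w u * a u) ^ p"
  proof (rule minkowski_weighted[OF fin w_sum w_nonneg])
    fix u assume u: "u \<in> U"
    show "0 < a u" using M B E by (auto simp: a_def)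
    show "0 \<le> G u x" for x by (auto simp: G_def F_nonneg)
    show "(\<Sum>x\<in>X. G u x ^ p) \<le> a u ^ p"
    proof (cases "u = u0")
      case True
      then show ?thesis unfolding G_def a_def using special_term[OF X \<omega> N M E(1)] by simp
    next
      case False
      have "(\<Sum>y\<in>(*) (\<rho> u) ` X. F y ^ p) \<le> B ^ p"
        using X separated_image_mult[OF X(2) m(2)[OF u]] d
        by (intro B image_rho_subset[OF u]) auto
      then show ?thesis using False by (simp add: G_def a_def sum_image_rho[OF u])
    qed
  qed auto
  also have "(\<Sum>u\<in>U. w u * a u) = w u0 * (E * M) + (\<Sum>u\<in>U - {u0}. w u * B)"
    using fin u0 by (subst sum.remove[of _ u0]) (auto simp: a_def intro!: sum.cong)
  also have "(\<Sum>u\<in>U - {u0}. w u * B) = (1 - w u0) * B"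
    using fin u0 w_sum by (simp add: sum_diff1 flip: sum_distrib_right)
  finally show ?thesis .
qed

lemma w_u0_le_1: "w u0 \<le> 1"
  using w_sum fin u0 w_nonneg member_le_sum[of u0 U w] by simp

lemma one_less_of_sep0_le:
  assumes "sep0 \<le> (real N - 1) * (m ^ k * sep0)"
  shows "1 < real N"
proof (rule ccontr)
  assume "\<not> 1 < real N"
  then have "(real N - 1) * (m ^ k * sep0) \<le> 0"
    using m(1) sep0_pos by (intro mult_nonpos_nonneg) auto
  then show False using assms sep0_pos by linarith
qed

text \<open>Iterating the recursion only along the non-special branches loses separation, but after \<open>L\<close>
  steps this affects only a proportion \<open>(1 - w u0) ^ L\<close> of the total weight.\<close>

lemma block:
  assumes \<omega>: "0 < \<omega>" "2 * \<omega> / D < m ^ L * sep0" "\<omega> \<le> pi / 4"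
    and N: "sep0 \<le> (real N - 1) * (m ^ Suc L * sep0)"
    and M: "\<And>Y. finite Y \<Longrightarrow> separated sep0 Y \<Longrightarrow> Y \<subseteq> {-T'..T'} \<Longrightarrow> (\<Sum>y\<in>Y. F y ^ p) \<le> M ^ p" "0 < M"
    and E: "1 + real N * cos \<omega> ^ p \<le> E ^ p" "0 < E"
    and E': "real N \<le> E' ^ p" "0 < E'"
    and T': "0 \<le> T'"
  shows "k \<le> L \<Longrightarrow> finite X \<Longrightarrow> separated (m ^ (L - k) * sep0) X \<Longrightarrow> X \<subseteq> {-T..T} \<Longrightarrow>
    (if k = 0 then T \<le> T' else R * T \<le> T') \<Longrightarrow>
    (\<Sum>x\<in>X. F x ^ p) \<le> (((1 - (1 - w u0) ^ k) * E + (1 - w u0) ^ k * E') * M) ^ p"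
proof (induction k arbitrary: X T)
  case 0
  \<comment> \<open>At the bottom all \<open>L\<close> losses of separation are repaired by a single
    colouring, whose price \<open>N\<close> is at most \<open>E' ^ p\<close>.\<close>
  have "sep0 \<le> (real N - 1) * (m ^ L * sep0)"
  proof -
    have "0 < real N - 1" using one_less_of_sep0_le[OF N] by simp
    then have "(real N - 1) * (m ^ Suc L * sep0) \<le> (real N - 1) * (m ^ L * sep0)"
      using m(1) m_less_1 sep0_pos by (intro mult_left_mono mult_right_mono power_decreasing) auto
    then show ?thesis using N by simp
  qed
  then have "(\<Sum>x\<in>X. F x ^ p) \<le> real N * M ^ p"
    using 0 M m(1) sep0_pos by (intro sum_le_of_sparser[where d = "m ^ L * sep0" and T = T']) auto
  also have "\<dots> \<le> E' ^ p * M ^ p" using E' M(2) by (intro mult_right_mono) auto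
  finally show ?case by (simp add: power_mult_distrib)
next
  case (Suc k)
  let ?d = "m ^ (L - Suc k) * sep0" and ?B = "((1 - (1 - w u0) ^ k) * E + (1 - w u0) ^ k * E') * M"
  have md: "m * ?d = m ^ (L - k) * sep0" using Suc.prems(1) by (simp add: Suc_diff_Suc flip: power_Suc)
  have le: "m ^ L * sep0 \<le> ?d" "m ^ Suc L * sep0 \<le> m * ?d" unfolding md
    using m(1) m_less_1 sep0_pos by (intro mult_right_mono power_decreasing; simp)+
  \<comment> \<open>With steps left, one contraction by \<open>R\<close> must lead into
    \<open>{-T'..T'}\<close>; at \<open>k = 0\<close> the set must already lie there.
    \<open>T\<close> may be negative, hence the case distinction.\<close>
  have RT: "R * (R * T) \<le> T'"
  proof (cases "0 \<le> T")
    case True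
    then have "R * (R * T) \<le> R * T" using R_pos R(1) by (intro mult_left_le_one_le) auto
    then show ?thesis using Suc.prems(5) by simp
  next
    case False
    then have "R * (R * T) \<le> 0" using R_pos by (auto intro!: mult_nonneg_nonpos)
    then show ?thesis using T' by simp
  qed
  have "(\<Sum>x\<in>X. F x ^ p) \<le> (w u0 * (E * M) + (1 - w u0) * ?B) ^ p"
  proof (rule step[OF Suc.prems(2-4)])
    show "R * T \<le> T'" using Suc.prems by simp
    show "2 * \<omega> / D < ?d" using \<omega> le by simp
    have "0 < real N - 1" using one_less_of_sep0_le[OF N] by simp
    then have "(real N - 1) * (m ^ Suc L * sep0) \<le> (real N - 1) * (m * ?d)"
      using le by (intro mult_left_mono) auto
    then show "sep0 \<le> (real N - 1) * (m * ?d)" using N by simp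
    have k: "0 \<le> (1 - w u0) ^ k" "(1 - w u0) ^ k \<le> 1"
      using w_u0 w_u0_le_1 by (auto intro: power_le_one)
    show "0 < ?B" using convex_comb_pos[OF k E(2) E'(2)] M(2) by simp
    show "(\<Sum>y\<in>Y. F y ^ p) \<le> ?B ^ p"
      if "finite Y" "separated (m * ?d) Y" "Y \<subseteq> {-(R * T)..R * T}" for Y
      using that Suc.prems RT unfolding md by (intro Suc.IH[where T = "R * T"]) auto
  qed (use \<omega> M E in auto)
  also have "w u0 * (E * M) + (1 - w u0) * ?B =
      ((1 - (1 - w u0) ^ Suc k) * E + (1 - w u0) ^ Suc k * E') * M"
    by (simp add: algebra_simps)
  finally show ?case .
qed

text \<open>The parameters are chosen in the order \<open>L\<close>, \<open>N\<close>,
  \<open>\<omega>\<close>, \<open>p\<close>. The first makes the averaged loss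
  \<open>\<kappa> ^ L * ln N\<close> small, \<open>\<omega>\<close> keeps close points isolated down
  to separation \<open>m ^ L * sep0\<close>, and \<open>p\<close> makes
  \<open>N * cos \<omega> ^ p\<close> small. Widening the window by \<open>1 / R\<close> then costs
  at most \<open>(1 / R) powr \<beta>\<close>.\<close>

lemma one_scale:
  assumes "0 < \<beta>"
  obtains p :: nat and A :: real where "1 \<le> p" "0 < A" "A ^ p \<le> (1 / R) powr \<beta>"
    "\<And>T M X. 0 \<le> T \<Longrightarrow> 0 < M \<Longrightarrow>
       (\<And>Y. finite Y \<Longrightarrow> separated sep0 Y \<Longrightarrow> Y \<subseteq> {-(R * T)..R * T} \<Longrightarrow> (\<Sum>y\<in>Y. F y ^ p) \<le> M ^ p) \<Longrightarrow>
       finite X \<Longrightarrow> separated sep0 X \<Longrightarrow> X \<subseteq> {-T..T} \<Longrightarrow> (\<Sum>x\<in>X. F x ^ p) \<le> (A * M) ^ p"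
proof -
  \<comment> \<open>The growth comes out as \<open>exp (4 * \<theta>)\<close>: two losses of
    \<open>\<theta>\<close> each, doubled by \<open>exp_le_one_plus_double\<close>.\<close>
  define \<theta> where "\<theta> = \<beta> * ln (1 / R) / 4"
  have th: "0 < \<theta>" using assms R_pos R(1) by (simp add: \<theta>_def)
  define \<kappa> where "\<kappa> = 1 - w u0"
  have \<kappa>: "0 \<le> \<kappa>" "\<kappa> < 1" using w_u0 w_u0_le_1 by (auto simp: \<kappa>_def)
  \<comment> \<open>The expression is
    \<open>\<kappa> ^ L * (ln 3 + real (Suc L) * ln (1 / m))\<close>, an upper bound for
    \<open>\<kappa> ^ L * ln N\<close>.\<close>
  have "(\<lambda>L. \<kappa> ^ L * (ln 3 + ln (1 / m)) + ln (1 / m) * (real L * \<kappa> ^ L)) \<longlonglongrightarrow> 0 * (ln 3 + ln (1 / m)) + ln (1 / m) * 0"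
    using \<kappa> by (intro tendsto_intros LIMSEQ_power_zero powser_times_n_limit_0) auto
  then have "\<forall>\<^sub>F L in sequentially. \<kappa> ^ L * (ln 3 + ln (1 / m)) + ln (1 / m) * (real L * \<kappa> ^ L) < \<theta>"
    using th by (intro order_tendstoD(2)) simp_all
  then have "\<forall>\<^sub>F L in sequentially. \<kappa> ^ L * (ln 3 + ln (1 / m)) + ln (1 / m) * (real L * \<kappa> ^ L) < \<theta> \<and> 1 \<le> L"
    using eventually_ge_at_top by (rule eventually_conj)
  then obtain L where L: "\<kappa> ^ L * (ln 3 + ln (1 / m)) + ln (1 / m) * (real L * \<kappa> ^ L) < \<theta>" "1 \<le> L"
    by (auto simp: eventually_sequentially)
  \<comment> \<open>One colour more than the ratio of the separations, since \<open>N\<close>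
    colours guarantee a gap of only \<open>N - 1\<close> cells.\<close>
  define N where "N = nat \<lceil>1 / m ^ Suc L\<rceil> + 1"
  have mL: "0 < m ^ Suc L" "m ^ Suc L \<le> 1" using m(1) m_less_1 by (auto intro: power_le_one simp del: power_Suc)
  have N_ge: "1 / m ^ Suc L \<le> real N - 1" unfolding N_def by (simp add: real_nat_ceiling_ge del: power_Suc)
  then have N: "sep0 \<le> (real N - 1) * (m ^ Suc L * sep0)"
  proof -
    have "1 \<le> (real N - 1) * m ^ Suc L" using N_ge mL(1) by (simp add: pos_divide_le_eq del: power_Suc)
    from mult_right_mono[OF this, of sep0] sep0_pos show ?thesis by (simp add: mult.assoc)
  qed
  have N_le: "real N \<le> 3 * (1 / m) ^ Suc L"
  proof -
    have "1 \<le> 1 / m ^ Suc L" using mL by (simp del: power_Suc)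
    moreover have "real N \<le> 1 / m ^ Suc L + 2" unfolding N_def
      using mL by (simp del: power_Suc) linarith
    ultimately show ?thesis by (simp add: power_one_over del: power_Suc)
  qed
  have N1: "1 < real N" by (rule one_less_of_sep0_le[OF N])
  have "ln (real N) \<le> ln (3 * (1 / m) ^ Suc L)" using N_le N1 by (intro ln_mono) auto
  also have "\<dots> = ln 3 + real (Suc L) * ln (1 / m)"
    using m(1) by (subst ln_mult) (auto simp: ln_realpow simp del: power_Suc)
  finally have "\<kappa> ^ L * ln (real N) \<le> \<kappa> ^ L * (ln 3 + real (Suc L) * ln (1 / m))"
    using \<kappa> by (intro mult_left_mono) auto
  also have "\<dots> < \<theta>" using L(1) by (simp add: algebra_simps)
  finally have kN: "\<kappa> ^ L * ln (real N) < \<theta>" .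
  define \<omega> where "\<omega> = min (pi / 4) (D * (m ^ L * sep0) / 4)"
  have \<omega>: "0 < \<omega>" "\<omega> \<le> pi / 4" using D m(1) sep0_pos by (auto simp: \<omega>_def)
  have "2 * \<omega> \<le> D * (m ^ L * sep0) / 2" by (simp add: \<omega>_def)
  also have "\<dots> < D * (m ^ L * sep0)" using D m(1) sep0_pos by simp
  finally have \<omega>': "2 * \<omega> / D < m ^ L * sep0" using D by (simp add: field_simps)
  have cw: "0 \<le> cos \<omega>" "cos \<omega> < 1"
    using \<omega> cos_monotone_0_pi[of 0 \<omega>] pi_gt_zero by (auto intro!: cos_ge_zero)
  have "(\<lambda>p. real N * cos \<omega> ^ p) \<longlonglongrightarrow> real N * 0" using cw by (intro tendsto_intros LIMSEQ_power_zero) auto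
  then have "\<forall>\<^sub>F p in sequentially. real N * cos \<omega> ^ p < \<theta>" using th by (intro order_tendstoD(2)) simp_all
  \<comment> \<open>Taking \<open>p\<close> at least \<open>\<theta>\<close> and \<open>ln N\<close>
    puts the exponents \<open>\<theta> / p\<close> and \<open>ln N / p\<close> into the unit
    interval, where the linear bound on \<open>exp\<close> holds.\<close>
  moreover have "\<forall>\<^sub>F p in sequentially. nat \<lceil>max 1 (max \<theta> (ln (real N)))\<rceil> \<le> p" by (rule eventually_ge_at_top)
  ultimately have "\<forall>\<^sub>F p in sequentially. real N * cos \<omega> ^ p < \<theta> \<and> nat \<lceil>max 1 (max \<theta> (ln (real N)))\<rceil> \<le> p"
    by (rule eventually_conj)
  then obtain p :: nat where p: "real N * cos \<omega> ^ p < \<theta>" "nat \<lceil>max 1 (max \<theta> (ln (real N)))\<rceil> \<le> p"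
    by (auto simp: eventually_sequentially)
  have p': "1 \<le> real p" "\<theta> \<le> real p" "ln (real N) \<le> real p" using p(2) by linarith+
  define E where "E = exp (\<theta> / p)"
  define E' where "E' = exp (ln (real N) / p)"
  have E: "1 + real N * cos \<omega> ^ p \<le> E ^ p" "0 < E"
  proof -
    have "E ^ p = exp \<theta>" using p' by (simp add: E_def flip: exp_of_nat_mult)
    then show "1 + real N * cos \<omega> ^ p \<le> E ^ p" using p(1) exp_ge_add_one_self[of \<theta>] by linarith
  qed (simp add: E_def)
  have E': "real N \<le> E' ^ p" "0 < E'"
    using p' N1 by (auto simp: E'_def simp flip: exp_of_nat_mult)
  define A where "A = (1 - \<kappa> ^ L) * E + \<kappa> ^ L * E'"
  have kL: "0 \<le> \<kappa> ^ L" "\<kappa> ^ L \<le> 1" using \<kappa> by (auto intro: power_le_one)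
  \<comment> \<open>\<open>E\<close> and \<open>E'\<close> are the \<open>p\<close>-th roots of
    \<open>exp \<theta>\<close> and \<open>N\<close>. To first order, averaging them averages the
    logarithms \<open>\<theta>\<close> and \<open>ln N\<close>, so the large \<open>N\<close> counts
    only as \<open>\<kappa> ^ L * ln N\<close>.\<close>
  have A_le: "A \<le> 1 + (4 * \<theta>) / p"
  proof -
    have "E \<le> 1 + 2 * (\<theta> / p)" unfolding E_def using th p' by (intro exp_le_one_plus_double) auto
    moreover have "E' \<le> 1 + 2 * (ln (real N) / p)" unfolding E'_def using N1 p' by (intro exp_le_one_plus_double) auto
    ultimately have "A \<le> (1 - \<kappa> ^ L) * (1 + 2 * (\<theta> / p)) + \<kappa> ^ L * (1 + 2 * (ln (real N) / p))"
      unfolding A_def using kL by (intro add_mono mult_left_mono) auto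
    also have "\<dots> = 1 + 2 * ((1 - \<kappa> ^ L) * \<theta> + \<kappa> ^ L * ln (real N)) / p" using p' by (simp add: field_simps)
    also have "\<dots> \<le> 1 + 2 * (1 * \<theta> + \<theta>) / p"
      using kN p' kL th by (intro add_left_mono divide_right_mono mult_left_mono add_mono mult_right_mono) auto
    finally show ?thesis by simp
  qed
  have A: "0 < A" unfolding A_def by (rule convex_comb_pos[OF kL E(2) E'(2)])
  have "A ^ p \<le> exp (4 * \<theta> / p) ^ p"
    using A A_le by (intro power_mono order_trans[OF A_le exp_ge_add_one_self]) auto
  also have "\<dots> = exp (4 * \<theta>)" using p' by (simp flip: exp_of_nat_mult)
  also have "\<dots> = (1 / R) powr \<beta>" using R_pos by (simp add: powr_def \<theta>_def)
  finally have Ap: "A ^ p \<le> (1 / R) powr \<beta>" .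
  show ?thesis
  proof (rule that[OF _ A Ap])
    show "1 \<le> p" using p' by simp
    fix T M X
    assume T: "0 \<le> T" and M: "0 < M"
      "\<And>Y. finite Y \<Longrightarrow> separated sep0 Y \<Longrightarrow> Y \<subseteq> {-(R * T)..R * T} \<Longrightarrow> (\<Sum>y\<in>Y. F y ^ p) \<le> M ^ p"
      and X: "finite X" "separated sep0 X" "X \<subseteq> {-T..T}"
    show "(\<Sum>x\<in>X. F x ^ p) \<le> (A * M) ^ p"
      unfolding A_def \<kappa>_def
      by (rule block[where L = L and k = L and T' = "R * T" and T = T])
        (use \<omega> \<omega>' N M E E' X T R_pos L(2) in auto)
  qed
qed

text \<open>Iterate \<open>one_scale\<close> over windows growing by \<open>1 / R\<close>, starting
  from \<open>{-1..1}\<close>, where \<open>F \<le> 1\<close> and the number of separated points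
  bound the sum.\<close>

theorem flattening:
  assumes "0 < \<beta>"
  obtains p :: nat and C :: real where "1 \<le> p" "0 < C"
    "\<And>T X. 1 \<le> T \<Longrightarrow> finite X \<Longrightarrow> separated sep0 X \<Longrightarrow> X \<subseteq> {-T..T} \<Longrightarrow>
       (\<Sum>x\<in>X. F x ^ p) \<le> C * T powr \<beta>"
proof -
  obtain p :: nat and A :: real where p: "1 \<le> p" "0 < A" "A ^ p \<le> (1 / R) powr \<beta>"
    and scale: "\<And>T M X. 0 \<le> T \<Longrightarrow> 0 < M \<Longrightarrow>
       (\<And>Y. finite Y \<Longrightarrow> separated sep0 Y \<Longrightarrow> Y \<subseteq> {-(R * T)..R * T} \<Longrightarrow> (\<Sum>y\<in>Y. F y ^ p) \<le> M ^ p) \<Longrightarrow>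
       finite X \<Longrightarrow> separated sep0 X \<Longrightarrow> X \<subseteq> {-T..T} \<Longrightarrow> (\<Sum>x\<in>X. F x ^ p) \<le> (A * M) ^ p"
    using one_scale[OF assms] by blast
  define M where "M = 2 / sep0 + 2"
  have M1: "1 \<le> M" using sep0_pos by (simp add: M_def)
  have base: "(\<Sum>x\<in>X. F x ^ p) \<le> M ^ p" if "finite X" "separated sep0 X" "X \<subseteq> {-1..1}" for X
  proof -
    have "(\<Sum>x\<in>X. F x ^ p) \<le> (\<Sum>x\<in>X. 1)"
      by (intro sum_mono power_le_one F_nonneg F_le_1)
    also have "\<dots> \<le> M" unfolding M_def using card_separated_le[OF that(1,2) sep0_pos that(3)] by simp
    also have "\<dots> \<le> M ^ p" using M1 p(1) by (intro self_le_power) auto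
    finally show ?thesis .
  qed
  have scales: "(\<Sum>x\<in>X. F x ^ p) \<le> (A ^ j * M) ^ p"
    if "finite X" "separated sep0 X" "X \<subseteq> {-((1 / R) ^ j)..(1 / R) ^ j}" for j X
    using that
  proof (induction j arbitrary: X)
    case 0
    then show ?case using base by simp
  next
    case (Suc j)
    have "(\<Sum>x\<in>X. F x ^ p) \<le> (A * (A ^ j * M)) ^ p"
    proof (rule scale[where T = "(1 / R) ^ Suc j"])
      have "R * (1 / R) ^ Suc j = (1 / R) ^ j" using R_pos by simp
      then show "(\<Sum>y\<in>Y. F y ^ p) \<le> (A ^ j * M) ^ p"
        if "finite Y" "separated sep0 Y" "Y \<subseteq> {-(R * (1 / R) ^ Suc j)..R * (1 / R) ^ Suc j}" for Y
        using that Suc.IH by simp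
    qed (use Suc.prems R_pos p(2) M1 in auto)
    then show ?case by (simp add: mult.assoc)
  qed
  show ?thesis
  proof (rule that[OF p(1)])
    show "0 < M ^ p * (1 / R) powr \<beta>" using M1 R_pos by simp
    fix T :: real and X
    assume T: "1 \<le> T" and X: "finite X" "separated sep0 X" "X \<subseteq> {-T..T}"
    \<comment> \<open>Rounding up the number of scales costs one factor
      \<open>(1 / R) powr \<beta>\<close>, which goes into the constant.\<close>
    define j where "j = nat \<lceil>log (1 / R) T\<rceil>"
    have b: "1 < 1 / R" using R_pos R(1) by simp
    have lg: "0 \<le> log (1 / R) T" using T b by simp
    have "T = (1 / R) powr log (1 / R) T" using T b R_pos by simp
    also have "\<dots> \<le> (1 / R) powr real j" unfolding j_def using b by (intro powr_mono real_nat_ceiling_ge) auto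
    also have "\<dots> = (1 / R) ^ j" using R_pos by (simp add: powr_realpow)
    finally have Tj: "T \<le> (1 / R) ^ j" .
    have "(\<Sum>x\<in>X. F x ^ p) \<le> (A ^ j * M) ^ p" using X Tj by (intro scales) auto
    also have "\<dots> = M ^ p * (A ^ p) ^ j" by (simp add: power_mult_distrib mult.commute flip: power_mult)
    also have "\<dots> \<le> M ^ p * ((1 / R) powr \<beta>) ^ j" using p M1 by (intro mult_left_mono power_mono) auto
    also have "((1 / R) powr \<beta>) ^ j = (1 / R) powr (real j * \<beta>)"
      using R_pos by (simp add: powr_powr mult.commute flip: powr_realpow)
    also have "\<dots> \<le> (1 / R) powr ((log (1 / R) T + 1) * \<beta>)"
    proof -
      have "real j \<le> log (1 / R) T + 1" using lg unfolding j_def by linarith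
      then show ?thesis using b assms by (intro powr_mono mult_right_mono) auto
    qed
    also have "\<dots> = ((1 / R) powr log (1 / R) T) powr \<beta> * (1 / R) powr \<beta>"
      by (simp add: powr_powr powr_add algebra_simps)
    also have "(1 / R) powr log (1 / R) T = T" using T b R_pos by simp
    finally show "(\<Sum>x\<in>X. F x ^ p) \<le> M ^ p * (1 / R) powr \<beta> * T powr \<beta>"
      using M1 by (simp add: mult_ac)
  qed
qed

end

section \<open>Self-similar measures\<close>

locale self_similar = prob_space \<mu> for \<mu> :: "real measure" +
  fixes n :: nat and r t p :: "nat \<Rightarrow> real" and lo hi :: real and a b :: nat and xa xb :: real
  assumes sets_\<mu>[simp, measurable_cong]: "sets \<mu> = sets borel"
    and r: "\<And>i. i < n \<Longrightarrow> r i \<noteq> 0" "\<And>i. i < n \<Longrightarrow> \<bar>r i\<bar> < 1"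
    and p: "\<And>i. i < n \<Longrightarrow> 0 < p i" "(\<Sum>i<n. p i) = 1"
    and selfsim: "\<And>A. A \<in> sets borel \<Longrightarrow>
      measure \<mu> A = (\<Sum>i<n. p i * measure (distr \<mu> borel (\<lambda>x. r i * x + t i)) A)"
    and lo_le_hi: "lo \<le> hi"
    and maps: "\<And>i x. i < n \<Longrightarrow> x \<in> {lo..hi} \<Longrightarrow> r i * x + t i \<in> {lo..hi}"
    and ab: "a < n" "b < n" "xa \<noteq> xb"
    and fixed_points: "r a * xa + t a = xa" "r b * xb + t b = xb"
begin

lemma space_\<mu>[simp]: "space \<mu> = UNIV"
  using sets_eq_imp_space_eq[OF sets_\<mu>] by simp

definition f :: "nat \<Rightarrow> real \<Rightarrow> real" where "f i x = r i * x + t i"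

lemma f_measurable[measurable]: "f i \<in> borel_measurable borel"
  unfolding f_def[abs_def] by measurable

lemma measure_selfsim:
  assumes [measurable]: "A \<in> sets borel"
  shows "measure \<mu> A = (\<Sum>i<n. p i * measure \<mu> {x. f i x \<in> A})"
  by (subst selfsim[OF assms], intro sum.cong refl, subst measure_distr)
    (auto simp: f_def vimage_def)

text \<open>Self-similarity is given for the measures of sets. Presenting \<open>\<mu>\<close> as
  the law of a random map, chosen with weights \<open>p\<close>, at an independent
  \<open>\<mu>\<close>-distributed point carries it over to integrals by Fubini.\<close>

lemma mixture_eq:
  defines "P \<equiv> point_measure {..<n} (\<lambda>i. ennreal (p i)) \<Otimes>\<^sub>M \<mu>"
  shows "(\<lambda>z. f (fst z) (snd z)) \<in> borel_measurable P" (is ?meas)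
    and "\<mu> = distr P borel (\<lambda>z. f (fst z) (snd z))" (is ?eq)
proof -
  let ?P0 = "point_measure {..<n} (\<lambda>i. ennreal (p i))"
  have [measurable_cong]: "sets ?P0 = sets (count_space {..<n})" by (simp add: sets_point_measure)
  show [measurable]: ?meas
  proof -
    have "(\<lambda>z. f (fst z) (snd z)) \<in> borel_measurable (count_space {..<n} \<Otimes>\<^sub>M \<mu>)"
      by (rule measurable_pair_measure_countable1) auto
    moreover have "sets P = sets (count_space {..<n} \<Otimes>\<^sub>M \<mu>)"
      unfolding P_def by (intro sets_pair_measure_cong) (auto simp: sets_point_measure)
    ultimately show ?thesis by (simp cong: measurable_cong_sets)
  qed
  show ?eq
  proof (rule measure_eqI)
    fix A assume "A \<in> sets \<mu>"
    then have [measurable]: "A \<in> sets borel" by simp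
    have "emeasure (distr P borel (\<lambda>z. f (fst z) (snd z))) A = emeasure P ((\<lambda>z. f (fst z) (snd z)) -` A \<inter> space P)"
      by (simp add: emeasure_distr)
    also have "\<dots> = (\<integral>\<^sup>+i. emeasure \<mu> (Pair i -` ((\<lambda>z. f (fst z) (snd z)) -` A \<inter> space P)) \<partial>?P0)"
      unfolding P_def by (rule emeasure_pair_measure_alt) (use measurable_sets[OF \<open>?meas\<close>, of A] in \<open>simp add: P_def\<close>)
    also have "\<dots> = (\<Sum>i<n. ennreal (p i) * emeasure \<mu> (Pair i -` ((\<lambda>z. f (fst z) (snd z)) -` A \<inter> space P)))"
      by (subst nn_integral_point_measure_finite) auto
    also have "\<dots> = (\<Sum>i<n. ennreal (p i * measure \<mu> {x. f i x \<in> A}))"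
    proof (rule sum.cong)
      fix i assume i: "i \<in> {..<n}"
      then have "Pair i -` ((\<lambda>z. f (fst z) (snd z)) -` A \<inter> space P) = {x. f i x \<in> A}"
        by (auto simp: P_def space_pair_measure space_point_measure)
      then show "ennreal (p i) * emeasure \<mu> (Pair i -` ((\<lambda>z. f (fst z) (snd z)) -` A \<inter> space P)) =
          ennreal (p i * measure \<mu> {x. f i x \<in> A})"
        using i p(1)[of i] by (simp add: emeasure_eq_measure ennreal_mult' less_imp_le)
    qed simp
    also have "\<dots> = ennreal (\<Sum>i<n. p i * measure \<mu> {x. f i x \<in> A})"
      using p(1) by (intro sum_ennreal mult_nonneg_nonneg) (auto intro: less_imp_le)
    also have "\<dots> = emeasure \<mu> A" by (simp add: emeasure_eq_measure flip: measure_selfsim)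
    finally show "emeasure \<mu> A = emeasure (distr P borel (\<lambda>z. f (fst z) (snd z))) A" by simp
  qed simp
qed

lemma integral_selfsim:
  fixes g :: "real \<Rightarrow> 'b::{banach, second_countable_topology}"
  assumes [measurable]: "g \<in> borel_measurable borel" and B: "\<And>x. norm (g x) \<le> B"
  shows "(\<integral>x. g x \<partial>\<mu>) = (\<Sum>i<n. p i *\<^sub>R (\<integral>x. g (f i x) \<partial>\<mu>))"
proof -
  define P0 where "P0 = point_measure {..<n} (\<lambda>i. ennreal (p i))"
  note mix = mixture_eq[folded P0_def]
  interpret P0: finite_measure P0
    unfolding P0_def by (intro finite_measureI) (simp add: space_point_measure emeasure_point_measure_finite)
  interpret PP: pair_sigma_finite P0 \<mu> ..
  interpret PF: finite_measure "P0 \<Otimes>\<^sub>M \<mu>"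
  proof
    show "emeasure (P0 \<Otimes>\<^sub>M \<mu>) (space (P0 \<Otimes>\<^sub>M \<mu>)) \<noteq> \<infinity>"
      by (simp add: space_pair_measure emeasure_pair_measure_Times ennreal_mult_eq_top_iff emeasure_space_1[simplified])
  qed
  note [measurable] = mix(1)
  have "(\<integral>x. g x \<partial>\<mu>) = (\<integral>z. g (f (fst z) (snd z)) \<partial>(P0 \<Otimes>\<^sub>M \<mu>))"
    by (subst mix(2), subst integral_distr) auto
  also have "\<dots> = (\<integral>i. \<integral>x. g (f i x) \<partial>\<mu> \<partial>P0)"
  proof (subst PP.integral_fst'[symmetric])
    show "integrable (P0 \<Otimes>\<^sub>M \<mu>) (\<lambda>z. g (f (fst z) (snd z)))"
      by (rule PF.integrable_const_bound[where B = B]) (auto simp: B)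
  qed simp
  also have "\<dots> = (\<Sum>i<n. p i *\<^sub>R (\<integral>x. g (f i x) \<partial>\<mu>))"
    unfolding P0_def using p(1) by (subst lebesgue_integral_point_measure_finite) (auto intro: less_imp_le)
  finally show ?thesis .
qed

lemma char_selfsim: "char \<mu> s = (\<Sum>i<n. complex_of_real (p i) * iexp (s * t i) * char \<mu> (r i * s))"
proof -
  have "char \<mu> s = (\<Sum>i<n. p i *\<^sub>R (CLINT x|\<mu>. iexp (s * f i x)))"
    unfolding char_def by (rule integral_selfsim[where B = 1]) auto
  also have "\<dots> = (\<Sum>i<n. complex_of_real (p i) * iexp (s * t i) * char \<mu> (r i * s))"
  proof (rule sum.cong)
    fix i
    have "iexp (s * f i x) = iexp (s * t i) * iexp (r i * s * x)" for x
      by (simp add: f_def algebra_simps flip: exp_add)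
    then show "p i *\<^sub>R (CLINT x|\<mu>. iexp (s * f i x)) = complex_of_real (p i) * iexp (s * t i) * char \<mu> (r i * s)"
      unfolding char_def by (simp add: scaleR_conv_of_real)
  qed simp
  finally show ?thesis .
qed

lemma norm_char_le_1: "norm (char \<mu> s) \<le> 1"
  unfolding char_def
  by (rule order_trans[OF integral_norm_bound]) (simp add: prob_space[simplified])

definition rmin :: real where "rmin = Min ((\<lambda>i. \<bar>r i\<bar>) ` {..<n})"
definition rmax :: real where "rmax = Max ((\<lambda>i. \<bar>r i\<bar>) ` {..<n})"

lemma rmin_le: "i < n \<Longrightarrow> rmin \<le> \<bar>r i\<bar>" and le_rmax: "i < n \<Longrightarrow> \<bar>r i\<bar> \<le> rmax"
  by (auto simp: rmin_def rmax_def)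

lemma rmin_pos: "0 < rmin" and rmax_less_1: "rmax < 1"
proof -
  have "{..<n} \<noteq> {}" using ab by auto
  then show "0 < rmin" "rmax < 1" using r by (auto simp: rmin_def rmax_def)
qed

lemma rmax_pos: "0 < rmax" and rmin_less_1: "rmin < 1"
  using rmin_le[OF ab(1)] le_rmax[OF ab(1)] rmin_pos rmax_less_1 by auto

section \<open>Cosine recursion for the Fourier transform\<close>

definition shift :: "nat \<times> nat \<Rightarrow> real" where "shift u = t (fst u) + r (fst u) * t (snd u)"

text \<open>The difference of the two translations is
  \<open>(1 - r a) * (1 - r b) * (xa - xb)\<close>: affine contractions commute only if they share
  their fixed point.\<close>

lemma shift_ab_ne_shift_ba: "shift (a, b) \<noteq> shift (b, a)"
proof
  assume eq: "shift (a, b) = shift (b, a)"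
  have ta: "t a = xa * (1 - r a)" and tb: "t b = xb * (1 - r b)" using fixed_points by (auto simp: algebra_simps)
  have "(1 - r a) * (1 - r b) * (xa - xb) = shift (a, b) - shift (b, a)"
    by (simp add: shift_def ta tb algebra_simps)
  with eq ab(3) r[OF ab(1)] r[OF ab(2)] show False by auto
qed

lemma a_ne_b: "a \<noteq> b"
proof
  assume "a = b"
  then have "(1 - r a) * (xa - xb) = 0" using fixed_points by (simp add: algebra_simps)
  then show False using ab(3) r[OF ab(1)] by auto
qed

lemma norm_iexp_add: "norm (iexp x + iexp y) = 2 * \<bar>cos ((x - y) / 2)\<bar>"
proof -
  have "iexp x + iexp y = iexp ((x + y) / 2) * (iexp ((x - y) / 2) + iexp (- ((x - y) / 2)))"
    by (simp add: distrib_left add_divide_distrib diff_divide_distrib algebra_simps flip: exp_add)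
  also have "iexp ((x - y) / 2) + iexp (- ((x - y) / 2)) = of_real (2 * cos ((x - y) / 2))"
    by (simp only: cis_conv_exp[symmetric]) (simp add: complex_eq_iff)
  finally show ?thesis by (simp add: norm_mult)
qed

text \<open>The word \<open>ba\<close> is absorbed into \<open>ab\<close>, which therefore carries
  double weight; both have probability \<open>p a * p b\<close> and the same ratio.\<close>

definition pairs :: "(nat \<times> nat) set" where "pairs = {..<n} \<times> {..<n} - {(b, a)}"
definition pair_weight :: "nat \<times> nat \<Rightarrow> real" where
  "pair_weight u = (if u = (a, b) then 2 else 1) * (p (fst u) * p (snd u))"
definition pair_ratio :: "nat \<times> nat \<Rightarrow> real" where "pair_ratio u = r (fst u) * r (snd u)"
definition freq :: real where "freq = \<bar>shift (a, b) - shift (b, a)\<bar> / 2"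

text \<open>The words \<open>ab\<close> and \<open>ba\<close> have the same contraction ratio but different translations; merging
  their contributions produces the cosine.\<close>

lemma norm_char_rec:
  "norm (char \<mu> s) \<le> (\<Sum>u\<in>pairs. pair_weight u *
     ((if u = (a, b) then \<bar>cos (freq * s)\<bar> else 1) * norm (char \<mu> (pair_ratio u * s))))"
proof -
  define T where "T u = complex_of_real (p (fst u) * p (snd u)) * iexp (s * shift u) * char \<mu> (pair_ratio u * s)" for u
  let ?I = "{..<n} \<times> {..<n}" and ?V = "{..<n} \<times> {..<n} - {(b, a)} - {(a, b)}"
  have "char \<mu> s = (\<Sum>i<n. \<Sum>j<n. T (i, j))"
    unfolding char_selfsim[of s]
  proof (rule sum.cong)
    fix i
    have "complex_of_real (p i) * iexp (s * t i) *
        (complex_of_real (p j) * iexp (r i * s * t j) * char \<mu> (r j * (r i * s))) = T (i, j)" for j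
    proof -
      have "iexp (s * t i) * iexp (r i * s * t j) = iexp (s * shift (i, j))"
        by (simp add: shift_def algebra_simps flip: exp_add)
      then show ?thesis by (simp add: T_def pair_ratio_def algebra_simps)
    qed
    then show "complex_of_real (p i) * iexp (s * t i) * char \<mu> (r i * s) = (\<Sum>j<n. T (i, j))"
      by (subst char_selfsim) (simp add: sum_distrib_left)
  qed simp
  also have "\<dots> = sum T ?I" by (simp add: sum.cartesian_product)
  also have "\<dots> = T (b, a) + (T (a, b) + sum T ?V)"
    using ab a_ne_b by (subst sum.remove[of _ "(b, a)"], simp, simp, subst sum.remove[of _ "(a, b)"]) auto
  finally have "norm (char \<mu> s) \<le> norm (T (a, b) + T (b, a)) + norm (sum T ?V)"
    by (metis (no_types, lifting) ab_semigroup_add_class.add_ac(1) add.commute norm_triangle_ineq)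
  also have "norm (sum T ?V) \<le> (\<Sum>u\<in>?V. norm (T u))" by (rule norm_sum)
  also have "T (a, b) + T (b, a) = complex_of_real (p a * p b) * (iexp (s * shift (a, b)) + iexp (s * shift (b, a))) * char \<mu> (pair_ratio (a, b) * s)"
    by (simp add: T_def pair_ratio_def algebra_simps)
  also have "norm \<dots> = pair_weight (a, b) * (\<bar>cos (freq * s)\<bar> * norm (char \<mu> (pair_ratio (a, b) * s)))"
  proof -
    have "\<bar>cos ((s * shift (a, b) - s * shift (b, a)) / 2)\<bar> = \<bar>cos (freq * s)\<bar>"
    proof -
      have "(s * shift (a, b) - s * shift (b, a)) / 2 = freq * s \<or> (s * shift (a, b) - s * shift (b, a)) / 2 = - (freq * s)"
        by (auto simp: freq_def abs_if algebra_simps diff_divide_distrib)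
      then show ?thesis by (metis cos_minus)
    qed
    then have "norm (iexp (s * shift (a, b)) + iexp (s * shift (b, a))) = 2 * \<bar>cos (freq * s)\<bar>"
      using norm_iexp_add[of "s * shift (a, b)" "s * shift (b, a)"] by simp
    then show ?thesis using p(1)[OF ab(1)] p(1)[OF ab(2)]
      by (simp only: norm_mult) (simp add: norm_mult pair_weight_def)
  qed
  also have "(\<Sum>u\<in>?V. norm (T u)) = (\<Sum>u\<in>?V. pair_weight u *
     ((if u = (a, b) then \<bar>cos (freq * s)\<bar> else 1) * norm (char \<mu> (pair_ratio u * s))))"
    by (rule sum.cong) (auto simp: T_def pair_weight_def norm_mult p(1) less_imp_le abs_mult)
  finally show ?thesis unfolding pairs_def
    using ab a_ne_b by (subst sum.remove[of _ "(a, b)"]) auto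
qed

sublocale char: cos_recursion "\<lambda>s. norm (char \<mu> s)" pairs pair_weight pair_ratio "(a, b)" freq "rmin\<^sup>2" "rmax\<^sup>2"
proof
  show "(\<Sum>u\<in>pairs. pair_weight u) = 1"
  proof -
    let ?q = "\<lambda>u. p (fst u) * p (snd u)"
    have "(\<Sum>u\<in>pairs. pair_weight u) = (\<Sum>u\<in>pairs. ?q u) + ?q (a, b)"
      using ab a_ne_b unfolding pairs_def
      by (subst (1 2) sum.remove[of _ "(a, b)"]) (auto simp: pair_weight_def intro!: sum.cong)
    also have "\<dots> = sum ?q ({..<n} \<times> {..<n})"
      using ab unfolding pairs_def by (subst (2) sum.remove[of _ "(b, a)"]) auto
    also have "\<dots> = (\<Sum>i<n. p i) * (\<Sum>j<n. p j)" by (simp add: sum_product sum.cartesian_product case_prod_unfold)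
    finally show ?thesis using p by simp
  qed
  show "rmin\<^sup>2 \<le> \<bar>pair_ratio u\<bar>" "\<bar>pair_ratio u\<bar> \<le> rmax\<^sup>2" if "u \<in> pairs" for u
    using that rmin_le le_rmax rmin_pos rmax_pos
    by (auto simp: pairs_def pair_ratio_def abs_mult power2_eq_square intro!: mult_mono)
  show "rmax\<^sup>2 < 1" using rmax_pos rmax_less_1 by (simp add: power_less_one_iff)
  show "0 < freq" using shift_ab_ne_shift_ba by (simp add: freq_def)
qed (use ab a_ne_b p rmin_pos norm_char_rec norm_char_le_1 in
    \<open>auto simp: pairs_def pair_weight_def intro!: mult_nonneg_nonneg less_imp_le\<close>)

section \<open>Support and Frostman property\<close>

lemma prob_dilated_interval: "prob {lo - rmax ^ k * e..hi + rmax ^ k * e} \<ge> prob {lo - e..hi + e}" if "0 \<le> e"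
proof (induction k)
  case (Suc k)
  let ?I = "\<lambda>e. {lo - e..hi + e}" and ?e = "rmax ^ k * e"
  have e: "0 \<le> ?e" using that rmax_pos by simp
  have "prob (?I ?e) = (\<Sum>i<n. p i * prob (?I ?e))" using p by (simp flip: sum_distrib_right)
  also have "\<dots> \<le> (\<Sum>i<n. p i * prob {x. f i x \<in> ?I (rmax * ?e)})"
  proof (intro sum_mono mult_left_mono finite_measure_mono)
    fix i assume "i \<in> {..<n}"
    then have i: "i < n" by simp
    \<comment> \<open>A contraction that preserves \<open>{lo..hi}\<close> brings points within
      \<open>?e\<close> of it to within \<open>rmax * ?e\<close>; so mass only moves
      inwards.\<close>
    show "?I ?e \<subseteq> {x. f i x \<in> ?I (rmax * ?e)}"
    proof
      fix x assume x: "x \<in> ?I ?e"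
      show "x \<in> {x. f i x \<in> ?I (rmax * ?e)}"
      proof -
        define y where "y = min hi (max lo x)"
        have y: "y \<in> {lo..hi}" "\<bar>x - y\<bar> \<le> ?e" using x e lo_le_hi by (auto simp: y_def)
        have "f i x = f i y + r i * (x - y)" by (simp add: f_def algebra_simps)
        moreover have "\<bar>r i * (x - y)\<bar> \<le> rmax * ?e"
          unfolding abs_mult using y(2) le_rmax[OF i] rmax_pos by (intro mult_mono) auto
        ultimately show ?thesis using maps[OF i y(1)] by (auto simp: f_def)
      qed
    qed
  qed (use p in \<open>auto intro: less_imp_le\<close>)
  also have "\<dots> = prob (?I (rmax * ?e))" by (subst (2) measure_selfsim) auto
  finally show ?case using Suc by (simp add: mult.assoc)
qed simp

text \<open>By shrinking with \<open>k\<close>, no neighbourhood of the invariant interval has more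
  mass than the interval itself; neighbourhoods of growing radius exhaust the line. So the interval,
  which comes with the maps alone, carries \<open>\<mu>\<close>.\<close>

lemma prob_lo_hi: "prob {lo..hi} = 1"
proof -
  have lim: "(\<lambda>k. prob {lo - rmax ^ k * e..hi + rmax ^ k * e}) \<longlonglongrightarrow> prob (\<Inter>k. {lo - rmax ^ k * e..hi + rmax ^ k * e})"
    if "0 \<le> e" for e
  proof (rule finite_Lim_measure_decseq)
    show "decseq (\<lambda>k. {lo - rmax ^ k * e..hi + rmax ^ k * e})"
    proof (rule decseq_SucI)
      fix k
      have "rmax ^ Suc k * e \<le> rmax ^ k * e"
        using that rmax_pos rmax_less_1 by (intro mult_right_mono power_decreasing) auto
      then show "{lo - rmax ^ Suc k * e..hi + rmax ^ Suc k * e} \<subseteq> {lo - rmax ^ k * e..hi + rmax ^ k * e}" by auto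
    qed
  qed auto
  have inter: "(\<Inter>k. {lo - rmax ^ k * e..hi + rmax ^ k * e}) \<subseteq> {lo..hi}" for e
  proof
    fix x assume "x \<in> (\<Inter>k. {lo - rmax ^ k * e..hi + rmax ^ k * e})"
    then have x: "lo - rmax ^ k * e \<le> x" "x \<le> hi + rmax ^ k * e" for k by auto
    have l: "(\<lambda>k. rmax ^ k * e) \<longlonglongrightarrow> 0 * e" using rmax_pos rmax_less_1 by (intro tendsto_intros LIMSEQ_power_zero) auto
    have "lo - 0 * e \<le> x" by (rule LIMSEQ_le_const2[OF tendsto_diff[OF tendsto_const l]]) (use x in auto)
    moreover have "x \<le> hi + 0 * e" by (rule LIMSEQ_le_const[OF tendsto_add[OF tendsto_const l]]) (use x in auto)
    ultimately show "x \<in> {lo..hi}" by simp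
  qed
  have ge: "prob {lo - real e..hi + real e} \<le> prob {lo..hi}" for e :: nat
  proof -
    have "prob {lo - real e..hi + real e} \<le> prob (\<Inter>k. {lo - rmax ^ k * real e..hi + rmax ^ k * real e})"
      by (rule LIMSEQ_le_const[OF lim]) (use prob_dilated_interval in auto)
    also have "\<dots> \<le> prob {lo..hi}" by (intro finite_measure_mono inter) auto
    finally show ?thesis .
  qed
  have "(\<lambda>e. prob {lo - real e..hi + real e}) \<longlonglongrightarrow> prob (\<Union>e. {lo - real e..hi + real e})"
    by (rule finite_Lim_measure_incseq) (auto simp: incseq_def)
  moreover have "(\<Union>e. {lo - real e..hi + real e}) = UNIV"
  proof safe
    fix x :: real
    obtain e :: nat where "max (x - hi) (lo - x) \<le> real e" using real_arch_simple by blast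
    then show "x \<in> (\<Union>e. {lo - real e..hi + real e})" by (auto intro!: exI[of _ e])
  qed simp
  ultimately have "(\<lambda>e. prob {lo - real e..hi + real e}) \<longlonglongrightarrow> 1" using prob_space by simp
  then have "1 \<le> prob {lo..hi}" by (rule LIMSEQ_le_const2) (use ge in auto)
  then show ?thesis by (simp add: antisym)
qed

lemma AE_lo_hi: "AE x in \<mu>. x \<in> {lo..hi}"
  using prob_lo_hi by (subst prob_eq_1[symmetric]) auto

lemma f_preimage_interval:
  assumes "i < n"
  shows "\<exists>u' v'. {x. f i x \<in> {u..v}} = {u'..v'} \<and> v' - u' = (v - u) / \<bar>r i\<bar>"
proof (cases "0 < r i")
  case True
  then have "{x. f i x \<in> {u..v}} = {(u - t i) / r i..(v - t i) / r i}" by (auto simp: f_def field_simps)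
  then show ?thesis using True by (intro exI conjI) (assumption, simp add: diff_divide_distrib)
next
  case False
  with r(1)[OF assms] have neg: "r i < 0" by simp
  then have "{x. f i x \<in> {u..v}} = {(v - t i) / r i..(u - t i) / r i}" by (auto simp: f_def field_simps)
  then show ?thesis using neg by (intro exI conjI) (assumption, simp add: diff_divide_distrib)
qed

text \<open>Follow the letter \<open>c\<close> for \<open>j\<close> steps. A branch that leaves it
  sees the interval enlarged to length at most \<open>l\<close> and is bounded by \<open>B\<close>;
  the branch using only \<open>c\<close> survives, with the \<open>j\<close>-th iterate of
  \<open>f c\<close> written out around its fixed point.\<close>

lemma prob_interval_iterate:
  assumes c: "c < n" "r c * xc + t c = xc"
    and B: "\<And>u v. v - u \<le> l \<Longrightarrow> prob {u..v} \<le> B"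
  shows "v - u \<le> rmin ^ j * l \<Longrightarrow> 0 \<le> l \<Longrightarrow>
    prob {u..v} \<le> (1 - p c ^ j) * B + p c ^ j * prob {x. xc + r c ^ j * (x - xc) \<in> {u..v}}"
proof (induction j arbitrary: u v)
  case (Suc j)
  have pre: "\<exists>u' v'. {x. f i x \<in> {u..v}} = {u'..v'} \<and> v' - u' \<le> rmin ^ j * l" if i: "i < n" for i
  proof -
    obtain u' v' where uv: "{x. f i x \<in> {u..v}} = {u'..v'}" "v' - u' = (v - u) / \<bar>r i\<bar>"
      using f_preimage_interval[OF i] by blast
    have "(v - u) / \<bar>r i\<bar> \<le> rmin * (rmin ^ j * l) / \<bar>r i\<bar>"
      using Suc.prems by (intro divide_right_mono) auto
    also have "\<dots> \<le> \<bar>r i\<bar> * (rmin ^ j * l) / \<bar>r i\<bar>"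
      using Suc.prems rmin_pos rmin_le[OF i] by (intro divide_right_mono mult_right_mono) auto
    also have "\<dots> = rmin ^ j * l" using r(1)[OF i] by simp
    finally have "v' - u' \<le> rmin ^ j * l" using uv(2) by simp
    with uv(1) show ?thesis by blast
  qed
  have "prob {u..v} = (\<Sum>i<n. p i * prob {x. f i x \<in> {u..v}})" by (rule measure_selfsim) simp
  also have "\<dots> = p c * prob {x. f c x \<in> {u..v}} + (\<Sum>i\<in>{..<n} - {c}. p i * prob {x. f i x \<in> {u..v}})"
    using c by (subst sum.remove[of _ c]) auto
  also have "(\<Sum>i\<in>{..<n} - {c}. p i * prob {x. f i x \<in> {u..v}}) \<le> (\<Sum>i\<in>{..<n} - {c}. p i * B)"
  proof (intro sum_mono mult_left_mono)
    fix i assume "i \<in> {..<n} - {c}"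
    then have i: "i < n" by simp
    obtain u' v' where uv: "{x. f i x \<in> {u..v}} = {u'..v'}" "v' - u' \<le> rmin ^ j * l"
      using pre[OF i] by blast
    have "rmin ^ j * l \<le> l" using Suc.prems rmin_pos rmin_less_1 by (intro mult_left_le_one_le) (auto intro: power_le_one)
    then show "prob {x. f i x \<in> {u..v}} \<le> B" using uv B by simp
    show "0 \<le> p i" using p(1)[OF i] by simp
  qed
  also have "\<dots> = (1 - p c) * B" using p c by (simp add: sum_diff1 flip: sum_distrib_right)
  also have "prob {x. f c x \<in> {u..v}} \<le>
      (1 - p c ^ j) * B + p c ^ j * prob {x. xc + r c ^ j * (x - xc) \<in> {x. f c x \<in> {u..v}}}"
  proof -
    obtain u' v' where uv: "{x. f c x \<in> {u..v}} = {u'..v'}" "v' - u' \<le> rmin ^ j * l"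
      using pre[OF c(1)] by blast
    show ?thesis unfolding uv(1) by (rule Suc.IH[OF uv(2) Suc.prems(2)])
  qed
  also have "f c (xc + r c ^ j * (x - xc)) = xc + r c ^ Suc j * (x - xc)" for x
    using c(2) by (simp add: f_def algebra_simps)
  then have "{x. xc + r c ^ j * (x - xc) \<in> {x. f c x \<in> {u..v}}} = {x. xc + r c ^ Suc j * (x - xc) \<in> {u..v}}"
    by simp
  finally show ?case using p(1)[OF c(1)] by (simp add: algebra_simps)
next
  case 0
  have "{u..v} = {x. u \<le> x \<and> x \<le> v}" by auto
  then show ?case by simp
qed

text \<open>A short interval cannot meet the images of the support under high iterates of both \<open>f a\<close> and
  \<open>f b\<close>, so at each fixed number of steps down a definite proportion of the mass is lost.\<close>

lemma frostman:
  obtains C \<sigma> where "0 < C" "0 < \<sigma>" "\<And>u v l. v - u \<le> l \<Longrightarrow> 0 < l \<Longrightarrow> prob {u..v} \<le> C * l powr \<sigma>"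
proof -
  define M where "M = \<bar>lo - xa\<bar> + \<bar>hi - xa\<bar> + \<bar>lo - xb\<bar> + \<bar>hi - xb\<bar>"
  have M: "\<bar>x - xa\<bar> \<le> M" "\<bar>x - xb\<bar> \<le> M" if "x \<in> {lo..hi}" for x
    using that unfolding M_def by auto
  define d where "d = \<bar>xa - xb\<bar>"
  have d: "0 < d" using ab by (simp add: d_def)
  have "(\<lambda>j. rmax ^ j * M) \<longlonglongrightarrow> 0 * M" using rmax_pos rmax_less_1 by (intro tendsto_intros LIMSEQ_power_zero) auto
  then have "\<forall>\<^sub>F j in sequentially. rmax ^ j * M < d / 4" using d by (intro order_tendstoD(2)) auto
  then obtain N where "\<And>j. N \<le> j \<Longrightarrow> rmax ^ j * M < d / 4" by (auto simp: eventually_sequentially)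
  \<comment> \<open>After this many iterates the image of \<open>{lo..hi}\<close> lies within
    \<open>d / 4\<close> of the fixed point. The successor keeps the exponent positive, as required
    for \<open>0 < q\<close> and \<open>\<rho> < 1\<close>.\<close>
  from this[of "Suc N"] have N: "rmax ^ Suc N * M < d / 4" by simp
  define q where "q = 1 - min (p a) (p b) ^ Suc N"
  define \<rho> where "\<rho> = rmin ^ Suc N"
  have \<rho>: "0 < \<rho>" "\<rho> < 1" using rmin_pos rmin_less_1 by (auto simp: \<rho>_def power_Suc_less_one simp del: power_Suc)
  have pab: "p a + p b \<le> 1"
  proof -
    have "sum p {a, b} \<le> sum p {..<n}" using ab p by (intro sum_mono2) (auto intro: less_imp_le)
    then show ?thesis using a_ne_b p by simp
  qed
  have q: "0 < q" "q < 1"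
  proof -
    have "min (p a) (p b) ^ Suc N < 1" using p ab pab by (intro power_Suc_less_one) (auto simp: min_def)
    then show "0 < q" by (simp add: q_def)
    show "q < 1" using p ab by (simp add: q_def)
  qed
  have scales: "v - u \<le> d / 4 * \<rho> ^ k \<Longrightarrow> prob {u..v} \<le> q ^ k" for u v k
  proof (induction k arbitrary: u v)
    case (Suc k)
    have small: "d / 4 * \<rho> ^ Suc k \<le> d / 4 * 1"
      using d \<rho> by (intro mult_left_mono power_le_one) auto
    have key: "prob {u..v} \<le> q ^ Suc k"
      if c: "c < n" "r c * xc + t c = xc" "min (p a) (p b) \<le> p c"
        and away: "\<And>y. y \<in> {u..v} \<Longrightarrow> d / 4 < \<bar>y - xc\<bar>" and Mc: "\<And>x. x \<in> {lo..hi} \<Longrightarrow> \<bar>x - xc\<bar> \<le> M" for c xc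
    proof -
      have "{x. xc + r c ^ Suc N * (x - xc) \<in> {u..v}} \<subseteq> UNIV - {lo..hi}"
      proof safe
        fix x assume x: "xc + r c ^ Suc N * (x - xc) \<in> {u..v}" "x \<in> {lo..hi}"
        have "\<bar>r c ^ Suc N * (x - xc)\<bar> \<le> rmax ^ Suc N * M"
          unfolding abs_mult power_abs using Mc[OF x(2)] le_rmax[OF c(1)] rmax_pos
          by (intro mult_mono power_mono) auto
        then show False using away[OF x(1)] N by simp
      qed simp
      then have "prob {x. xc + r c ^ Suc N * (x - xc) \<in> {u..v}} \<le> prob (UNIV - {lo..hi})"
        by (intro finite_measure_mono) auto
      also have "\<dots> = 0" using prob_compl[of "{lo..hi}"] prob_lo_hi by simp
      finally have zero: "prob {x. xc + r c ^ Suc N * (x - xc) \<in> {u..v}} = 0" by (simp add: antisym)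
      have "prob {u..v} \<le> (1 - p c ^ Suc N) * q ^ k + p c ^ Suc N * prob {x. xc + r c ^ Suc N * (x - xc) \<in> {u..v}}"
        using Suc d \<rho> by (intro prob_interval_iterate[where l = "d / 4 * \<rho> ^ k"] c) (auto simp: \<rho>_def mult_ac)
      also have "\<dots> \<le> q * q ^ k" unfolding zero
      proof -
        have "min (p a) (p b) ^ Suc N \<le> p c ^ Suc N" using c(3) p ab by (intro power_mono) (auto simp: min_def less_imp_le)
        then show "(1 - p c ^ Suc N) * q ^ k + p c ^ Suc N * 0 \<le> q * q ^ k"
          using q by (simp add: q_def mult_right_mono del: power_Suc)
      qed
      finally show ?thesis by simp
    qed
    \<comment> \<open>An interval of length at most \<open>d / 4\<close> that comes within
      \<open>d / 4\<close> of \<open>xa\<close> stays farther than \<open>d / 4\<close> from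
      \<open>xb\<close>.\<close>
    show ?case
    proof (cases "\<exists>y\<in>{u..v}. \<bar>y - xa\<bar> \<le> d / 4")
      case False
      then show ?thesis using fixed_points ab M by (intro key[of a xa]) (auto simp: not_le)
    next
      case True
      then obtain y where y: "y \<in> {u..v}" "\<bar>y - xa\<bar> \<le> d / 4" by blast
      have "d / 4 < \<bar>z - xb\<bar>" if "z \<in> {u..v}" for z
      proof -
        have "\<bar>z - y\<bar> \<le> v - u" using that y(1) by auto
        then have "\<bar>z - y\<bar> \<le> d / 4" using Suc.prems small by linarith
        moreover have "d \<le> \<bar>y - xa\<bar> + \<bar>z - y\<bar> + \<bar>z - xb\<bar>" unfolding d_def by linarith
        ultimately show ?thesis using y(2) d by linarith
      qed
      then show ?thesis using fixed_points ab M by (intro key[of b xb]) auto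
    qed
  qed simp
  \<comment> \<open>The solution of \<open>\<rho> powr \<sigma> = q\<close>: shrinking an interval
    by \<open>\<rho>\<close> lowers the mass bound by the factor \<open>q\<close>.\<close>
  define \<sigma> where "\<sigma> = ln q / ln \<rho>"
  have \<sigma>: "0 < \<sigma>" using q \<rho> by (simp add: \<sigma>_def divide_neg_neg)
  show ?thesis
  proof (rule that[OF _ \<sigma>])
    \<comment> \<open>The factor \<open>1 / q\<close> pays for rounding down the number of scales;
      for \<open>l\<close> above \<open>d / 4\<close> the bound exceeds 1 and is trivial.\<close>
    show "0 < 1 / q * (1 / (d / 4)) powr \<sigma>" using q d by simp
    fix u v l :: real assume l: "v - u \<le> l" "0 < l"
    define z where "z = l / (d / 4)"
    have z: "0 < z" using l d by (simp add: z_def)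
    have "prob {u..v} \<le> 1 / q * z powr \<sigma>"
    proof (cases "z \<le> 1")
      case True
      define k where "k = nat \<lfloor>log \<rho> z\<rfloor>"
      have lg: "0 \<le> log \<rho> z" using z True \<rho> by (simp add: log_def divide_nonpos_neg)
      have k: "real k \<le> log \<rho> z" "log \<rho> z \<le> real k + 1" using lg unfolding k_def by linarith+
      have "z = \<rho> powr log \<rho> z" using z \<rho> by simp
      also have "\<dots> \<le> \<rho> powr real k" using k \<rho> by (intro powr_mono') auto
      finally have "l \<le> d / 4 * \<rho> ^ k" using d \<rho> by (simp add: z_def powr_realpow field_simps)
      then have "prob {u..v} \<le> q ^ k" using l by (intro scales) simp
      also have "\<dots> = q powr real k" using q by (simp add: powr_realpow)
      also have "\<dots> \<le> q powr (log \<rho> z - 1)" using k q by (intro powr_mono') auto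
      also have "\<dots> = 1 / q * q powr log \<rho> z" using q by (simp add: powr_diff)
      also have "q powr log \<rho> z = z powr \<sigma>" using q z by (simp add: powr_def \<sigma>_def log_def)
      finally show ?thesis .
    next
      case False
      then have "1 * 1 \<le> 1 / q * z powr \<sigma>" using q \<sigma> by (intro mult_mono ge_one_powr_ge_zero) auto
      then show ?thesis using prob_le_1[of "{u..v}"] by linarith
    qed
    also have "z powr \<sigma> = (1 / (d / 4)) powr \<sigma> * l powr \<sigma>"
      using l d by (subst powr_mult[symmetric]) (auto simp: z_def mult.commute)
    finally show "prob {u..v} \<le> 1 / q * (1 / (d / 4)) powr \<sigma> * l powr \<sigma>" by simp
  qed
qed

end

section \<open>Decomposition into small copies\<close>

context self_similar
begin

primrec word_map :: "nat list \<Rightarrow> real \<Rightarrow> real" where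
  "word_map [] x = x"
| "word_map (i # v) x = f i (word_map v x)"

definition word_ratio :: "nat list \<Rightarrow> real" where "word_ratio v = prod_list (map r v)"
definition word_prob :: "nat list \<Rightarrow> real" where "word_prob v = prod_list (map p v)"

lemma word_map_snoc: "word_map (v @ [i]) x = word_map v (f i x)"
  by (induction v) auto

lemma word_map_diff: "word_map v x - word_map v y = word_ratio v * (x - y)"
proof (induction v)
  case (Cons i v)
  have "word_map (i # v) x - word_map (i # v) y = r i * (word_map v x - word_map v y)"
    by (simp add: f_def algebra_simps)
  with Cons show ?case by (simp add: word_ratio_def)
qed (simp add: word_ratio_def)

lemma word_map_measurable[measurable]: "word_map v \<in> borel_measurable borel"
  by (induction v) (simp_all add: measurable_compose[OF _ f_measurable])

lemma word_map_lo_hi: "set v \<subseteq> {..<n} \<Longrightarrow> x \<in> {lo..hi} \<Longrightarrow> word_map v x \<in> {lo..hi}"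
proof (induction v)
  case (Cons i v)
  then show ?case using maps[of i "word_map v x"] by (auto simp: f_def)
qed simp

lemma word_prob_nonneg: "set v \<subseteq> {..<n} \<Longrightarrow> 0 \<le> word_prob v"
  unfolding word_prob_def by (intro prod_list_nonneg) (auto intro: less_imp_le p(1))

lemma abs_word_ratio_le: "set v \<subseteq> {..<n} \<Longrightarrow> \<bar>word_ratio v\<bar> \<le> rmax ^ length v"
  using le_rmax rmax_pos by (induction v) (auto simp: word_ratio_def abs_mult intro!: mult_mono)

text \<open>Words are extended on the right until their ratio falls below \<open>h\<close>, so that
  all copies have comparable size although the maps contract differently. The cut-off
  \<open>k\<close> makes the recursion structural; once \<open>rmax ^ k < h\<close>, every word has
  stopped.\<close>

primrec stop_words :: "real \<Rightarrow> nat \<Rightarrow> nat list set" where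
  "stop_words h 0 = {[]}"
| "stop_words h (Suc k) = {v \<in> stop_words h k. \<bar>word_ratio v\<bar> < h} \<union>
     (\<lambda>(v, i). v @ [i]) ` ({v \<in> stop_words h k. h \<le> \<bar>word_ratio v\<bar>} \<times> {..<n})"

lemma finite_stop_words[simp]: "finite (stop_words h k)"
  by (induction k) auto

lemma stop_words_subset: "v \<in> stop_words h k \<Longrightarrow> set v \<subseteq> {..<n}"
proof (induction k arbitrary: v)
  case (Suc k)
  then show ?case by (auto dest: Suc.IH[THEN subsetD])
qed simp

lemma stop_words_length: "v \<in> stop_words h k \<Longrightarrow> length v \<le> k"
  by (induction k arbitrary: v) force+

lemma stop_words_length_eq: "v \<in> stop_words h k \<Longrightarrow> h \<le> \<bar>word_ratio v\<bar> \<Longrightarrow> length v = k"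
  by (induction k arbitrary: v) auto

lemma stop_words_ratio_ge:
  assumes "0 < h" "h \<le> 1"
  shows "v \<in> stop_words h k \<Longrightarrow> rmin * h \<le> \<bar>word_ratio v\<bar>"
proof (induction k arbitrary: v)
  case 0
  then show ?case using assms rmin_pos rmin_less_1 by (auto simp: word_ratio_def mult_le_one)
next
  case (Suc k)
  then consider "v \<in> stop_words h k" | w i where "v = w @ [i]" "h \<le> \<bar>word_ratio w\<bar>" "i < n" by auto
  then show ?case
  proof cases
    case 2
    then have "rmin * h \<le> \<bar>r i\<bar> * \<bar>word_ratio w\<bar>"
      using assms rmin_le by (intro mult_mono) auto
    then show ?thesis using 2 by (simp add: word_ratio_def abs_mult mult.commute)
  qed (use Suc in auto)
qed

lemma stop_words_ratio_less:
  assumes "rmax ^ k < h" "v \<in> stop_words h k"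
  shows "\<bar>word_ratio v\<bar> < h"
  using assms stop_words_length_eq[OF assms(2)] abs_word_ratio_le[OF stop_words_subset[OF assms(2)]]
  by (cases "h \<le> \<bar>word_ratio v\<bar>") auto

lemma integral_stop_words:
  fixes g :: "real \<Rightarrow> 'b::{banach, second_countable_topology}"
  assumes [measurable]: "g \<in> borel_measurable borel" and B: "\<And>x. norm (g x) \<le> B"
  shows "(\<integral>x. g x \<partial>\<mu>) = (\<Sum>v\<in>stop_words h k. word_prob v *\<^sub>R (\<integral>x. g (word_map v x) \<partial>\<mu>))"
proof (induction k)
  case 0
  then show ?case by (simp add: word_prob_def)
next
  case (Suc k)
  let ?I = "\<lambda>v. word_prob v *\<^sub>R (\<integral>x. g (word_map v x) \<partial>\<mu>)"
  let ?S = "{v \<in> stop_words h k. \<bar>word_ratio v\<bar> < h}" and ?L = "{v \<in> stop_words h k. h \<le> \<bar>word_ratio v\<bar>}"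
  let ?c = "\<lambda>(v, i). v @ [i]"
  have split: "?I v = (\<Sum>i<n. ?I (v @ [i]))" for v
  proof -
    have "(\<integral>x. g (word_map v x) \<partial>\<mu>) = (\<Sum>i<n. p i *\<^sub>R (\<integral>x. g (word_map v (f i x)) \<partial>\<mu>))"
      by (rule integral_selfsim[OF _ B]) measurable
    then show ?thesis by (simp add: scaleR_sum_right word_map_snoc word_prob_def)
  qed
  have "(\<integral>x. g x \<partial>\<mu>) = sum ?I ?S + sum ?I ?L"
    unfolding Suc by (subst sum.union_disjoint[symmetric]) (auto intro: sum.cong)
  also have "sum ?I ?L = (\<Sum>v\<in>?L. \<Sum>i<n. ?I (v @ [i]))" by (intro sum.cong refl split)
  also have "\<dots> = (\<Sum>z\<in>?L \<times> {..<n}. ?I (?c z))" by (simp add: sum.cartesian_product case_prod_unfold)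
  also have "\<dots> = sum ?I (?c ` (?L \<times> {..<n}))" by (subst sum.reindex) (auto simp: inj_on_def)
  also have "sum ?I ?S + \<dots> = sum ?I (stop_words h (Suc k))"
    unfolding stop_words.simps
  proof (intro sum.union_disjoint[symmetric])
    \<comment> \<open>Unstopped words of round \<open>k\<close> have length exactly
      \<open>k\<close>, so their extensions are new.\<close>
    have False if "v @ [i] \<in> stop_words h k" "v \<in> stop_words h k" "h \<le> \<bar>word_ratio v\<bar>" for v i
      using stop_words_length[OF that(1)] stop_words_length_eq[OF that(2,3)] by simp
    then show "?S \<inter> ?c ` (?L \<times> {..<n}) = {}" by auto
  qed auto
  finally show ?case .
qed

lemma sum_word_prob: "(\<Sum>v\<in>stop_words h k. word_prob v) = 1"
  using integral_stop_words[of "\<lambda>_. 1::real" 1 h k] prob_space by simp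

lemma measure_stop_words:
  assumes [measurable]: "A \<in> sets borel"
  shows "prob A = (\<Sum>v\<in>stop_words h k. word_prob v * prob {x. word_map v x \<in> A})"
proof -
  have "prob A = (\<integral>x. indicator A x \<partial>\<mu>)" by simp
  also have "\<dots> = (\<Sum>v\<in>stop_words h k. word_prob v *\<^sub>R (\<integral>x. indicator A (word_map v x) \<partial>\<mu>))"
    by (rule integral_stop_words[where B = 1]) (auto simp: indicator_def)
  also have "\<dots> = (\<Sum>v\<in>stop_words h k. word_prob v * prob {x. word_map v x \<in> A})"
  proof (rule sum.cong)
    fix v
    have "(\<integral>x. indicator A (word_map v x) \<partial>\<mu>) = (\<integral>x. indicator {x. word_map v x \<in> A} x \<partial>\<mu>)"
      by (rule Bochner_Integration.integral_cong) (auto simp: indicator_def)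
    also have "\<dots> = prob {x. word_map v x \<in> A}" by simp
    finally show "word_prob v *\<^sub>R (\<integral>x. indicator A (word_map v x) \<partial>\<mu>) = word_prob v * prob {x. word_map v x \<in> A}"
      by simp
  qed simp
  finally show ?thesis .
qed

lemma word_ratio_eq_prod_count:
  "set v \<subseteq> {..<n} \<Longrightarrow> word_ratio v = (\<Prod>i<n. r i ^ count_list v i)"
proof (induction v)
  case (Cons j v)
  have "(\<Prod>i<n. r i ^ count_list (j # v) i) = (\<Prod>i<n. (if i = j then r i else 1) * r i ^ count_list v i)"
    by (rule prod.cong) auto
  also have "\<dots> = (\<Prod>i<n. if i = j then r i else 1) * (\<Prod>i<n. r i ^ count_list v i)" by (rule prod.distrib)
  also have "(\<Prod>i<n. if i = j then r i else 1) = r j" using Cons.prems by simp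
  finally show ?case using Cons by (simp add: word_ratio_def)
qed (simp add: word_ratio_def)

text \<open>Contraction ratios commute, so a ratio is determined by how often each letter occurs.\<close>

lemma card_word_ratio: "card (word_ratio ` stop_words h k) \<le> (k + 1) ^ n"
proof -
  let ?P = "PiE {..<n} (\<lambda>_. {..k})"
  have "word_ratio ` stop_words h k \<subseteq> (\<lambda>c. \<Prod>i<n. r i ^ c i) ` ?P"
  proof
    fix \<rho> assume "\<rho> \<in> word_ratio ` stop_words h k"
    then obtain v where v: "v \<in> stop_words h k" "\<rho> = word_ratio v" by auto
    define c where "c = restrict (count_list v) {..<n}"
    have "c \<in> ?P"
      using count_le_length[of v] stop_words_length[OF v(1)] by (auto simp: c_def intro: order_trans)
    moreover have "\<rho> = (\<Prod>i<n. r i ^ c i)"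
      using v word_ratio_eq_prod_count[OF stop_words_subset[OF v(1)]] by (simp add: c_def)
    ultimately show "\<rho> \<in> (\<lambda>c. \<Prod>i<n. r i ^ c i) ` ?P" by blast
  qed
  then have "card (word_ratio ` stop_words h k) \<le> card ?P"
    by (rule surj_card_le[rotated]) (auto intro: finite_PiE)
  also have "\<dots> = (k + 1) ^ n" by (simp add: card_PiE)
  finally show ?thesis .
qed

section \<open>Generic base points and masses of nearby copies\<close>

lemma prob_one_preimage:
  assumes [measurable]: "A \<in> sets borel" and A: "prob A = 1" and i: "i < n"
  shows "prob {x. f i x \<in> A} = 1"
proof (rule ccontr)
  assume "prob {x. f i x \<in> A} \<noteq> 1"
  then have "prob {x. f i x \<in> A} < 1" by (simp add: less_le)
  then have "(\<Sum>j<n. p j * prob {x. f j x \<in> A}) < (\<Sum>j<n. p j * 1)"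
    using i p(1) by (intro sum_strict_mono_ex1) (auto intro!: mult_left_mono less_imp_le)
  then show False using A measure_selfsim[of A] p(2) by simp
qed

lemma AE_word_map:
  assumes "set v \<subseteq> {..<n}" "A \<in> sets borel" "AE x in \<mu>. x \<in> A"
  shows "AE x in \<mu>. word_map v x \<in> A"
proof -
  have "prob {x. word_map v x \<in> A} = 1"
    using assms(1)
  proof (induction v rule: rev_induct)
    case Nil
    then show ?case using assms(2,3) by (simp add: prob_eq_1[symmetric])
  next
    case (snoc i v)
    note [measurable] = assms(2)
    show ?case using prob_one_preimage[of "{x. word_map v x \<in> A}" i] snoc by (simp add: word_map_snoc)
  qed
  moreover note [measurable] = assms(2)
  ultimately show ?thesis by (subst (asm) prob_eq_1) auto
qed

text \<open>\<open>{lo..hi}\<close> need not lie in \<open>J\<close>, so the base point is taken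
  from the mass: there are only countably many words, hence almost every point has all its images in
  \<open>A\<close>.\<close>

lemma ex_base_point:
  assumes "A \<in> sets borel" "AE x in \<mu>. x \<in> A"
  obtains x0 where "x0 \<in> {lo..hi}" "\<And>v. set v \<subseteq> {..<n} \<Longrightarrow> word_map v x0 \<in> A"
proof -
  have "AE x in \<mu>. \<forall>v. set v \<subseteq> {..<n} \<longrightarrow> word_map v x \<in> A"
    unfolding AE_all_countable using AE_word_map[OF _ assms] by auto
  with AE_lo_hi have "AE x in \<mu>. x \<in> {lo..hi} \<and> (\<forall>v. set v \<subseteq> {..<n} \<longrightarrow> word_map v x \<in> A)"
    by (rule AE_conjI)
  then have "\<exists>x. x \<in> {lo..hi} \<and> (\<forall>v. set v \<subseteq> {..<n} \<longrightarrow> word_map v x \<in> A)"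
    by (rule eventually_happens'[OF ae_filter_bot])
  then show ?thesis using that by blast
qed

text \<open>A copy whose base point is near \<open>c\<close> lies with its full weight in the
  interval enlarged by the copy size, so decomposing the mass of that interval over the words counts
  all these weights.\<close>

lemma mass_near_le:
  assumes h: "rmax ^ k < h" and x0: "x0 \<in> {lo..hi}"
  shows "(\<Sum>v\<in>{v \<in> stop_words h k. \<bar>word_map v x0 - c\<bar> \<le> e}. word_prob v)
    \<le> prob {c - e - h * (hi - lo)..c + e + h * (hi - lo)}"
proof -
  let ?I = "{c - e - h * (hi - lo)..c + e + h * (hi - lo)}" and ?V = "{v \<in> stop_words h k. \<bar>word_map v x0 - c\<bar> \<le> e}"
  have one: "prob {x. word_map v x \<in> ?I} = 1" if v: "v \<in> ?V" for v
  proof -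
    have "{lo..hi} \<subseteq> {x. word_map v x \<in> ?I}"
    proof
      fix x assume x: "x \<in> {lo..hi}"
      have "\<bar>word_map v x - word_map v x0\<bar> \<le> h * (hi - lo)"
        unfolding word_map_diff abs_mult
        using stop_words_ratio_less[OF h, of v] v x x0 by (intro mult_mono) auto
      with v have "\<bar>word_map v x - c\<bar> \<le> e + h * (hi - lo)" by simp linarith
      then show "x \<in> {x. word_map v x \<in> ?I}" by (simp add: abs_le_iff)
    qed
    then have "prob {lo..hi} \<le> prob {x. word_map v x \<in> ?I}" by (intro finite_measure_mono) auto
    then show ?thesis using prob_lo_hi by (simp add: antisym)
  qed
  have "(\<Sum>v\<in>?V. word_prob v) = (\<Sum>v\<in>?V. word_prob v * prob {x. word_map v x \<in> ?I})"
    by (rule sum.cong) (use one in auto)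
  also have "\<dots> \<le> (\<Sum>v\<in>stop_words h k. word_prob v * prob {x. word_map v x \<in> ?I})"
    by (intro sum_mono2) (auto intro!: mult_nonneg_nonneg word_prob_nonneg dest!: stop_words_subset)
  also have "\<dots> = prob ?I" by (rule measure_stop_words[symmetric]) simp
  finally show ?thesis .
qed

end

section \<open>Sums over frequency cells and Taylor expansion\<close>

lemma cell_sum_le:
  fixes \<xi> \<pi> :: "'a \<Rightarrow> real" and \<Phi> :: "real \<Rightarrow> real"
  assumes V: "finite V" and s: "0 < s" and nonneg: "\<And>x. 0 \<le> \<Phi> x" "\<And>v. v \<in> V \<Longrightarrow> 0 \<le> \<pi> v" "0 \<le> B"
    and mass: "\<And>j. (\<Sum>v\<in>{v\<in>V. \<lfloor>\<xi> v / s\<rfloor> = j}. \<pi> v) \<le> B"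
    and sep: "\<And>Z. Z \<subseteq> \<xi> ` V \<Longrightarrow> separated s Z \<Longrightarrow> sum \<Phi> Z \<le> K"
  shows "(\<Sum>v\<in>V. \<pi> v * \<Phi> (\<xi> v)) \<le> 2 * B * K"
proof -
  define cell where "cell v = \<lfloor>\<xi> v / s\<rfloor>" for v
  let ?J = "cell ` V"
  \<comment> \<open>In each cell the point where \<open>\<Phi>\<close> is largest represents all
    others; the total weight of the cell is at most \<open>B\<close>.\<close>
  have "\<exists>x. x \<in> \<xi> ` V \<and> \<lfloor>x / s\<rfloor> = j \<and> (\<forall>v\<in>V. cell v = j \<longrightarrow> \<Phi> (\<xi> v) \<le> \<Phi> x)" if j: "j \<in> ?J" for j
  proof -
    have fin: "finite {v\<in>V. cell v = j}" and "{v\<in>V. cell v = j} \<noteq> {}" using V j by auto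
    then obtain w where w: "w \<in> {v\<in>V. cell v = j}" "(MAX v\<in>{v\<in>V. cell v = j}. \<Phi> (\<xi> v)) = \<Phi> (\<xi> w)"
      by (rule obtains_MAX)
    have "\<Phi> (\<xi> v) \<le> \<Phi> (\<xi> w)" if "v \<in> V" "cell v = j" for v
      unfolding w(2)[symmetric] using fin that by (intro Max_ge) auto
    with w(1) show ?thesis by (intro exI[of _ "\<xi> w"]) (auto simp: cell_def)
  qed
  then obtain X where X: "\<And>j. j \<in> ?J \<Longrightarrow> X j \<in> \<xi> ` V" "\<And>j. j \<in> ?J \<Longrightarrow> \<lfloor>X j / s\<rfloor> = j"
    "\<And>j v. j \<in> ?J \<Longrightarrow> v \<in> V \<Longrightarrow> cell v = j \<Longrightarrow> \<Phi> (\<xi> v) \<le> \<Phi> (X j)"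
    by metis
  have injX: "inj_on X ?J" by (rule inj_onI) (metis X(2))
  have "(\<Sum>v\<in>V. \<pi> v * \<Phi> (\<xi> v)) = (\<Sum>j\<in>?J. \<Sum>v\<in>{v\<in>V. cell v = j}. \<pi> v * \<Phi> (\<xi> v))"
    using V by (intro sum.group[symmetric]) auto
  also have "\<dots> \<le> (\<Sum>j\<in>?J. (\<Sum>v\<in>{v\<in>V. cell v = j}. \<pi> v) * \<Phi> (X j))"
    unfolding sum_distrib_right using X(3) nonneg(2) by (intro sum_mono mult_left_mono) auto
  also have "\<dots> \<le> (\<Sum>j\<in>?J. B * \<Phi> (X j))"
    using mass nonneg(1) by (intro sum_mono mult_right_mono) (auto simp: cell_def)
  also have "\<dots> = B * sum \<Phi> (X ` ?J)" by (simp add: sum.reindex[OF injX] sum_distrib_left)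
  \<comment> \<open>Two colours suffice: representatives in different cells of the same parity are
    at least \<open>s\<close> apart.\<close>
  also have "sum \<Phi> (X ` ?J) \<le> real 2 * K"
  proof (rule sum_le_of_separated_subsets[where d = s and s = s])
    show "\<lfloor>x / s\<rfloor> \<noteq> \<lfloor>y / s\<rfloor>" if "x \<in> X ` ?J" "y \<in> X ` ?J" "x \<noteq> y" for x y
      using that X(2) by (metis imageE)
    show "sum \<Phi> Z \<le> K" if "Z \<subseteq> X ` ?J" "separated s Z" for Z
      using that X(1) by (intro sep) auto
  qed (use V s in auto)
  finally show ?thesis using nonneg(3) by (simp add: mult_left_mono mult.assoc mult.left_commute)
qed

lemma holder_on_const:
  assumes "holder_on \<alpha> J h"
  obtains L where "0 \<le> L" "\<And>x y. x \<in> J \<Longrightarrow> y \<in> J \<Longrightarrow> \<bar>h x - h y\<bar> \<le> L * \<bar>x - y\<bar> powr \<alpha>"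
proof -
  obtain L where L: "\<And>x y. x \<in> J \<Longrightarrow> y \<in> J \<Longrightarrow> \<bar>h x - h y\<bar> \<le> L * \<bar>x - y\<bar> powr \<alpha>"
    using assms by (auto simp: holder_on_def)
  show ?thesis
  proof (rule that[of "max 0 L"])
    fix x y assume "x \<in> J" "y \<in> J"
    then have "\<bar>h x - h y\<bar> \<le> L * \<bar>x - y\<bar> powr \<alpha>" by (rule L)
    also have "\<dots> \<le> max 0 L * \<bar>x - y\<bar> powr \<alpha>" by (intro mult_right_mono) auto
    finally show "\<bar>h x - h y\<bar> \<le> max 0 L * \<bar>x - y\<bar> powr \<alpha>" .
  qed simp
qed

text \<open>The mean value theorem gives the increment with the derivative at an intermediate point;
  the Hoelder bound moves that point to \<open>x\<close>.\<close>

lemma taylor_C1_holder: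
  assumes J: "is_interval J" and g: "g differentiable_on J" and \<alpha>: "0 < \<alpha>" and "0 \<le> L"
    and L: "\<And>x y. x \<in> J \<Longrightarrow> y \<in> J \<Longrightarrow> \<bar>deriv_within J g x - deriv_within J g y\<bar> \<le> L * \<bar>x - y\<bar> powr \<alpha>"
    and xy: "x \<in> J" "y \<in> J"
  shows "\<bar>g y - g x - deriv_within J g x * (y - x)\<bar> \<le> L * \<bar>y - x\<bar> powr (1 + \<alpha>)"
proof -
  let ?g' = "deriv_within J g"
  have deriv: "(g has_derivative (\<lambda>v. ?g' z * v)) (at z within J)" if "z \<in> J" for z
  proof -
    have "g differentiable (at z within J)" using g that by (simp add: differentiable_on_def)
    then have "(g has_vector_derivative ?g' z) (at z within J)"
      unfolding deriv_within_def by (simp add: vector_derivative_works)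
    then show ?thesis by (simp add: has_vector_derivative_def mult.commute)
  qed
  have mvt: "\<exists>z\<in>{u..v}. g v - g u = ?g' z * (v - u)" if "u \<in> J" "v \<in> J" "u \<le> v" for u v
  proof -
    have "{u..v} \<subseteq> J" using J that by (meson atLeastAtMost_iff is_interval_1 subsetI)
    then have "(g has_derivative (\<lambda>v. ?g' z * v)) (at z within {u..v})" if "z \<in> {u..v}" for z
      using deriv[of z] that by (blast intro: has_derivative_subset)
    then show ?thesis using mvt_very_simple[OF that(3), of g "\<lambda>z v. ?g' z * v"] by simp
  qed
  have "\<exists>z\<in>J. \<bar>z - x\<bar> \<le> \<bar>y - x\<bar> \<and> g y - g x = ?g' z * (y - x)"
  proof (cases "x \<le> y")
    case True
    then obtain z where "z \<in> {x..y}" "g y - g x = ?g' z * (y - x)" using mvt xy by blast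
    then show ?thesis using xy J by (intro bexI[of _ z]) (auto, meson is_interval_1)
  next
    case False
    then obtain z where "z \<in> {y..x}" "g x - g y = ?g' z * (x - y)" using mvt[of y x] xy by auto
    then show ?thesis using xy J by (intro bexI[of _ z]) (auto simp: algebra_simps, meson is_interval_1)
  qed
  then obtain z where z: "z \<in> J" "\<bar>z - x\<bar> \<le> \<bar>y - x\<bar>" "g y - g x = ?g' z * (y - x)" by blast
  have "\<bar>g y - g x - ?g' x * (y - x)\<bar> = \<bar>?g' z - ?g' x\<bar> * \<bar>y - x\<bar>"
    by (simp add: z(3) abs_mult flip: left_diff_distrib)
  also have "\<dots> \<le> (L * \<bar>z - x\<bar> powr \<alpha>) * \<bar>y - x\<bar>" using L z xy by (intro mult_right_mono) auto
  also have "\<dots> \<le> (L * \<bar>y - x\<bar> powr \<alpha>) * \<bar>y - x\<bar>"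
    using z \<alpha> \<open>0 \<le> L\<close> by (intro mult_right_mono mult_left_mono powr_mono2) auto
  also have "\<dots> = L * \<bar>y - x\<bar> powr (1 + \<alpha>)" by (simp add: powr_add)
  finally show ?thesis .
qed

section \<open>Decay for nonlinear images\<close>

lemma norm_iexp_diff_le: "norm (iexp x - iexp y) \<le> \<bar>x - y\<bar>"
proof -
  have "iexp x - iexp y = iexp y * (iexp (x - y) - 1)"
    by (simp add: right_diff_distrib flip: exp_add)
  then have "norm (iexp x - iexp y) = norm (iexp (x - y) - 1)"
    by (simp add: norm_mult)
  also have "\<dots> \<le> \<bar>x - y\<bar>" using iexp_approx1[of "x - y" 0] by simp
  finally show ?thesis .
qed

lemma sum_UNION_le:
  fixes w :: "'a \<Rightarrow> real"
  assumes "finite I" "\<And>i. i \<in> I \<Longrightarrow> finite (V i)" "\<And>i v. i \<in> I \<Longrightarrow> v \<in> V i \<Longrightarrow> 0 \<le> w v"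
  shows "sum w (\<Union>i\<in>I. V i) \<le> (\<Sum>i\<in>I. sum w (V i))"
  using assms
proof (induction I rule: finite_induct)
  case (insert i I)
  let ?U = "\<Union>i\<in>I. V i"
  have "sum w (V i \<union> ?U) + sum w (V i \<inter> ?U) = sum w (V i) + sum w ?U"
    using insert by (intro sum.union_inter) auto
  moreover have "0 \<le> sum w (V i \<inter> ?U)" using insert.prems by (intro sum_nonneg) auto
  moreover have "sum w ?U \<le> (\<Sum>i\<in>I. sum w (V i))" using insert by auto
  ultimately show ?case using insert.hyps by simp
qed simp

context self_similar
begin

text \<open>On each copy \<open>g\<close> is replaced by its tangent at the base point. The linear
  phase integrates to a value of \<open>char \<mu>\<close> times a number of modulus 1, and
  \<open>taylor_C1_holder\<close> bounds the phase error, as points of the copy are within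
  \<open>h * (hi - lo)\<close> of the base point.\<close>

lemma norm_integral_linearized:
  assumes J: "is_interval J" "closed J" "AE x in \<mu>. x \<in> J"
    and g: "g differentiable_on J" and \<alpha>: "0 < \<alpha>" and "0 \<le> L"
    and L: "\<And>x y. x \<in> J \<Longrightarrow> y \<in> J \<Longrightarrow> \<bar>deriv_within J g x - deriv_within J g y\<bar> \<le> L * \<bar>x - y\<bar> powr \<alpha>"
    and x0: "x0 \<in> {lo..hi}" "\<And>v. set v \<subseteq> {..<n} \<Longrightarrow> word_map v x0 \<in> J"
    and h: "rmax ^ k < h" and l: "0 < l"
  shows "norm (LINT x:J|\<mu>. iexp (2 * pi * l * g x)) \<le>
    (\<Sum>v\<in>stop_words h k. word_prob v *
      norm (char \<mu> (2 * pi * l * deriv_within J g (word_map v x0) * word_ratio v))) +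
    2 * pi * l * L * (h * (hi - lo)) powr (1 + \<alpha>)"
proof -
  \<comment> \<open>The decomposition requires a Borel integrand on the whole line, while
    \<open>g\<close> is known to be continuous only on the closed set \<open>J\<close>.\<close>
  define H where "H x = indicator J x *\<^sub>R iexp (2 * pi * l * g x)" for x
  define err where "err = 2 * pi * l * L * (h * (hi - lo)) powr (1 + \<alpha>)"
  let ?F = "\<lambda>v. norm (char \<mu> (2 * pi * l * deriv_within J g (word_map v x0) * word_ratio v))"
  have J_sets[measurable]: "J \<in> sets borel" using J(2) by simp
  have H_meas[measurable]: "H \<in> borel_measurable borel"
    unfolding H_def using differentiable_imp_continuous_on[OF g]
    by (intro borel_measurable_continuous_on_indicator) (auto intro!: continuous_intros)
  have H_le: "norm (H x) \<le> 1" for x by (simp add: H_def indicator_def)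
  have word: "norm (\<integral>x. H (word_map v x) \<partial>\<mu>) \<le> ?F v + err" if v: "v \<in> stop_words h k" for v
  proof -
    define y where "y = word_map v x0"
    define d where "d = deriv_within J g y"
    define e where "e x = iexp (2 * pi * l * (g y + d * (word_ratio v * (x - x0))))" for x
    note vs = stop_words_subset[OF v]
    have yJ: "y \<in> J" using x0(2)[OF vs] by (simp add: y_def)
    have [measurable]: "e \<in> borel_measurable borel" unfolding e_def[abs_def] by measurable
    have int_e: "integrable \<mu> e" by (rule integrable_const_bound[where B = 1]) (auto simp: e_def)
    have int_H: "integrable \<mu> (\<lambda>x. H (word_map v x))"
      by (rule integrable_const_bound[where B = 1]) (auto simp: H_le)
    have "(\<integral>x. e x \<partial>\<mu>) = (\<integral>x. iexp (2 * pi * l * (g y - d * word_ratio v * x0)) * iexp (2 * pi * l * d * word_ratio v * x) \<partial>\<mu>)"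
      by (rule Bochner_Integration.integral_cong) (auto simp: e_def algebra_simps simp flip: exp_add)
    also have "\<dots> = iexp (2 * pi * l * (g y - d * word_ratio v * x0)) * char \<mu> (2 * pi * l * d * word_ratio v)"
      by (simp add: char_def)
    finally have norm_e: "norm (\<integral>x. e x \<partial>\<mu>) = ?F v" by (simp add: norm_mult d_def y_def)
    have "AE x in \<mu>. norm (H (word_map v x) - e x) \<le> err"
      using AE_word_map[OF vs J_sets J(3)] AE_lo_hi
    proof eventually_elim
      case (elim x)
      define z where "z = word_map v x"
      have zy: "z - y = word_ratio v * (x - x0)" by (simp add: z_def y_def word_map_diff)
      have "\<bar>z - y\<bar> \<le> h * (hi - lo)" unfolding zy abs_mult
        using stop_words_ratio_less[OF h v] elim(2) x0(1) by (intro mult_mono) auto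
      then have le: "\<bar>z - y\<bar> powr (1 + \<alpha>) \<le> (h * (hi - lo)) powr (1 + \<alpha>)" using \<alpha> by (intro powr_mono2) auto
      have "norm (H z - e x) = norm (iexp (2 * pi * l * g z) - iexp (2 * pi * l * (g y + d * (z - y))))"
        using elim(1) by (simp add: H_def e_def z_def[symmetric] zy)
      also have "\<dots> \<le> \<bar>2 * pi * l * g z - 2 * pi * l * (g y + d * (z - y))\<bar>" by (rule norm_iexp_diff_le)
      also have "\<dots> = 2 * pi * l * \<bar>g z - g y - d * (z - y)\<bar>"
      proof -
        have "2 * pi * l * g z - 2 * pi * l * (g y + d * (z - y)) = 2 * pi * l * (g z - g y - d * (z - y))"
          by (simp add: algebra_simps)
        then show ?thesis using l by (simp add: abs_mult)
      qed
      also have "\<dots> \<le> 2 * pi * l * (L * \<bar>z - y\<bar> powr (1 + \<alpha>))"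
        unfolding d_def using elim(1) l yJ
        by (intro mult_left_mono taylor_C1_holder[OF J(1) g \<alpha> \<open>0 \<le> L\<close> L]) (auto simp: z_def)
      also have "\<dots> \<le> 2 * pi * l * (L * (h * (hi - lo)) powr (1 + \<alpha>))"
        using le l \<open>0 \<le> L\<close> by (intro mult_left_mono) auto
      finally show ?case by (simp add: z_def err_def mult.assoc)
    qed
    then have "(\<integral>x. norm (H (word_map v x) - e x) \<partial>\<mu>) \<le> (\<integral>x. err \<partial>\<mu>)"
      using int_e int_H by (intro integral_mono_AE) auto
    then have "norm (\<integral>x. H (word_map v x) - e x \<partial>\<mu>) \<le> err"
      using prob_space by (intro order_trans[OF integral_norm_bound]) simp
    moreover have "(\<integral>x. H (word_map v x) \<partial>\<mu>) = (\<integral>x. e x \<partial>\<mu>) + (\<integral>x. H (word_map v x) - e x \<partial>\<mu>)"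
      using int_e int_H by simp
    ultimately show ?thesis using norm_triangle_ineq[of "\<integral>x. e x \<partial>\<mu>" "\<integral>x. H (word_map v x) - e x \<partial>\<mu>"] norm_e
      by simp
  qed
  have "(LINT x:J|\<mu>. iexp (2 * pi * l * g x)) = (\<integral>x. H x \<partial>\<mu>)" by (simp add: set_lebesgue_integral_def H_def)
  also have "\<dots> = (\<Sum>v\<in>stop_words h k. word_prob v *\<^sub>R (\<integral>x. H (word_map v x) \<partial>\<mu>))"
    by (rule integral_stop_words[OF _ H_le]) measurable
  also have "norm \<dots> \<le> (\<Sum>v\<in>stop_words h k. norm (word_prob v *\<^sub>R (\<integral>x. H (word_map v x) \<partial>\<mu>)))" by (rule norm_sum)
  also have "\<dots> \<le> (\<Sum>v\<in>stop_words h k. word_prob v * (?F v + err))"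
    using word word_prob_nonneg[OF stop_words_subset] by (intro sum_mono) (auto intro!: mult_left_mono)
  also have "\<dots> = (\<Sum>v\<in>stop_words h k. word_prob v * ?F v) + err"
    by (simp add: distrib_left sum.distrib sum_word_prob flip: sum_distrib_right)
  finally show ?thesis by (simp add: err_def)
qed

text \<open>With the ratio fixed to \<open>\<rho>\<close>, a cell of frequencies confines
  \<open>G\<close> to a set of diameter below \<open>2 powr (- real N)\<close>. Non-flatness, read
  contrapositively, covers the base points by fewer than \<open>2 powr (\<epsilon> * real N)\<close>
  balls, and the Frostman bound limits the mass of the copies based in each ball.\<close>

lemma cell_mass_le:
  fixes G :: "real \<Rightarrow> real" and N :: nat
  assumes frost: "\<And>u v l. v - u \<le> l \<Longrightarrow> 0 < l \<Longrightarrow> prob {u..v} \<le> C * l powr \<sigma>" "0 < C"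
    and x0: "x0 \<in> {lo..hi}" "\<And>v. set v \<subseteq> {..<n} \<Longrightarrow> word_map v x0 \<in> J"
    and h: "rmax ^ k < h" "0 < h" "h \<le> 1" and l: "0 < l" and s: "0 < s"
    and nf: "\<And>A. bounded A \<Longrightarrow> A \<subseteq> J \<Longrightarrow> 2 powr (\<epsilon> * real N) \<le> real (covering_number (2 powr (- \<delta> * real N)) A) \<Longrightarrow>
        bounded (G ` A) \<Longrightarrow> 2 powr (- real N) \<le> diameter (G ` A)"
    and small: "s / (2 * pi * l * (rmin * h)) < 2 powr (- real N)"
  shows "(\<Sum>v\<in>{v \<in> {v \<in> stop_words h k. word_ratio v = \<rho>}. \<lfloor>2 * pi * l * G (word_map v x0) * word_ratio v / s\<rfloor> = j}. word_prob v)
    \<le> 2 powr (\<epsilon> * real N) * (C * (2 powr (- \<delta> * real N) + 2 * (h * (hi - lo))) powr \<sigma>)"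
proof -
  define V where "V = {v \<in> {v \<in> stop_words h k. word_ratio v = \<rho>}. \<lfloor>2 * pi * l * G (word_map v x0) * word_ratio v / s\<rfloor> = j}"
  define A where "A = (\<lambda>v. word_map v x0) ` V"
  define e where "e = 2 powr (- \<delta> * real N)"
  let ?M = "C * (e + 2 * (h * (hi - lo))) powr \<sigma>"
  have e: "0 < e" by (simp add: e_def)
  have hl: "0 \<le> h * (hi - lo)" using h lo_le_hi by simp
  have finV: "finite V" by (simp add: V_def)
  then have finA: "finite A" by (simp add: A_def)
  have AJ: "A \<subseteq> J" using x0(2) stop_words_subset by (auto simp: A_def V_def)
  have diff: "\<bar>G (word_map v x0) - G (word_map w x0)\<bar> \<le> s / (2 * pi * l * (rmin * h))" if v: "v \<in> V" and w: "w \<in> V" for v w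
  proof -
    have \<rho>: "rmin * h \<le> \<bar>\<rho>\<bar>" using stop_words_ratio_ge[OF h(2,3), of v k] v by (auto simp: V_def)
    have pos: "0 < rmin * h" using rmin_pos h by simp
    have "\<bar>2 * pi * l * G (word_map v x0) * \<rho> / s - 2 * pi * l * G (word_map w x0) * \<rho> / s\<bar> < 1"
    proof -
      have "\<lfloor>2 * pi * l * G (word_map v x0) * \<rho> / s\<rfloor> = \<lfloor>2 * pi * l * G (word_map w x0) * \<rho> / s\<rfloor>"
        using v w by (auto simp: V_def)
      then show ?thesis by linarith
    qed
    also have "2 * pi * l * G (word_map v x0) * \<rho> / s - 2 * pi * l * G (word_map w x0) * \<rho> / s =
        2 * pi * l * \<rho> / s * (G (word_map v x0) - G (word_map w x0))"
      by (simp add: algebra_simps diff_divide_distrib)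
    finally have "2 * pi * l * \<bar>\<rho>\<bar> / s * \<bar>G (word_map v x0) - G (word_map w x0)\<bar> < 1"
      using l s by (simp add: abs_mult)
    moreover have "2 * pi * l * (rmin * h) / s * \<bar>G (word_map v x0) - G (word_map w x0)\<bar> \<le>
        2 * pi * l * \<bar>\<rho>\<bar> / s * \<bar>G (word_map v x0) - G (word_map w x0)\<bar>"
      using \<rho> l s by (intro mult_right_mono divide_right_mono mult_left_mono) auto
    ultimately have "2 * pi * l * (rmin * h) / s * \<bar>G (word_map v x0) - G (word_map w x0)\<bar> < 1" by linarith
    moreover have "0 < 2 * pi * l * (rmin * h)" using pos l by simp
    ultimately show ?thesis using s by (simp only: pos_le_divide_eq) (simp add: field_simps)
  qed
  have "diameter (G ` A) \<le> s / (2 * pi * l * (rmin * h))"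
    using diff rmin_pos h l s by (intro diameter_le) (auto simp: A_def)
  then have "diameter (G ` A) < 2 powr (- real N)" using small by simp
  then have cov: "real (covering_number e A) < 2 powr (\<epsilon> * real N)"
    using nf[OF finite_imp_bounded[OF finA] AJ] finite_imp_bounded[OF finite_imageI[OF finA]]
    by (auto simp: e_def not_le[symmetric])
  \<comment> \<open>A finite set has a finite cover, so the least cardinality in
    \<open>covering_number\<close> is attained.\<close>
  have "\<exists>k F. finite F \<and> card F = k \<and> A \<subseteq> (\<Union>c\<in>F. ball c (e / 2))"
    using finA e by (intro exI[of _ "card A"] exI[of _ A]) auto
  then have "\<exists>F. finite F \<and> card F = covering_number e A \<and> A \<subseteq> (\<Union>c\<in>F. ball c (e / 2))"
    unfolding covering_number_def by (rule LeastI_ex)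
  then obtain F where F: "finite F" "card F = covering_number e A" "A \<subseteq> (\<Union>c\<in>F. ball c (e / 2))" by blast
  have ball_mass: "(\<Sum>v\<in>{v \<in> stop_words h k. \<bar>word_map v x0 - c\<bar> \<le> e / 2}. word_prob v) \<le> ?M" for c
  proof -
    have "(\<Sum>v\<in>{v \<in> stop_words h k. \<bar>word_map v x0 - c\<bar> \<le> e / 2}. word_prob v)
        \<le> prob {c - e / 2 - h * (hi - lo)..c + e / 2 + h * (hi - lo)}"
      by (rule mass_near_le[OF h(1) x0(1)])
    also have "\<dots> \<le> ?M" using e hl by (intro frost(1)) auto
    finally show ?thesis .
  qed
  have "(\<Sum>v\<in>V. word_prob v) \<le> (\<Sum>v\<in>(\<Union>c\<in>F. {v \<in> stop_words h k. \<bar>word_map v x0 - c\<bar> \<le> e / 2}). word_prob v)"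
  proof (rule sum_mono2)
    show "V \<subseteq> (\<Union>c\<in>F. {v \<in> stop_words h k. \<bar>word_map v x0 - c\<bar> \<le> e / 2})"
    proof
      fix v assume v: "v \<in> V"
      then obtain c where "c \<in> F" "word_map v x0 \<in> ball c (e / 2)" using F(3) by (auto simp: A_def)
      then show "v \<in> (\<Union>c\<in>F. {v \<in> stop_words h k. \<bar>word_map v x0 - c\<bar> \<le> e / 2})"
        using v by (auto simp: V_def dist_real_def abs_minus_commute intro!: bexI[of _ c])
    qed
  qed (use F(1) word_prob_nonneg[OF stop_words_subset] in auto)
  also have "\<dots> \<le> (\<Sum>c\<in>F. \<Sum>v\<in>{v \<in> stop_words h k. \<bar>word_map v x0 - c\<bar> \<le> e / 2}. word_prob v)"
    using F(1) word_prob_nonneg[OF stop_words_subset] by (intro sum_UNION_le) auto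
  also have "\<dots> \<le> (\<Sum>c\<in>F. ?M)" by (intro sum_mono ball_mass)
  also have "\<dots> = real (covering_number e A) * ?M" using F(2) by simp
  also have "\<dots> \<le> 2 powr (\<epsilon> * real N) * ?M"
    using cov frost(2) by (intro mult_right_mono) auto
  finally show ?thesis unfolding V_def e_def .
qed

text \<open>Jensen moves the power onto the Fourier transform. For each ratio,
  \<open>cell_sum_le\<close> combines the mass of a cell with flattening over representatives of the
  cells; the number of ratios gives the first factor.\<close>

lemma power_sum_le:
  fixes G :: "real \<Rightarrow> real" and N P :: nat
  assumes frost: "\<And>u v l. v - u \<le> l \<Longrightarrow> 0 < l \<Longrightarrow> prob {u..v} \<le> C * l powr \<sigma>" "0 < C"
    and flat: "\<And>T X. 1 \<le> T \<Longrightarrow> finite X \<Longrightarrow> separated s X \<Longrightarrow> X \<subseteq> {-T..T} \<Longrightarrow>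
       (\<Sum>x\<in>X. norm (char \<mu> x) ^ P) \<le> K * T powr \<epsilon>"
    and x0: "x0 \<in> {lo..hi}" "\<And>v. set v \<subseteq> {..<n} \<Longrightarrow> word_map v x0 \<in> J"
    and h: "rmax ^ k < h" "0 < h" "h \<le> 1" and l: "0 < l" and s: "0 < s"
    and nf: "\<And>A. bounded A \<Longrightarrow> A \<subseteq> J \<Longrightarrow> 2 powr (\<epsilon> * real N) \<le> real (covering_number (2 powr (- \<delta> * real N)) A) \<Longrightarrow>
        bounded (G ` A) \<Longrightarrow> 2 powr (- real N) \<le> diameter (G ` A)"
    and small: "s / (2 * pi * l * (rmin * h)) < 2 powr (- real N)"
    and T: "1 \<le> T" "\<And>v. v \<in> stop_words h k \<Longrightarrow> \<bar>2 * pi * l * G (word_map v x0) * word_ratio v\<bar> \<le> T"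
  shows "(\<Sum>v\<in>stop_words h k. word_prob v * norm (char \<mu> (2 * pi * l * G (word_map v x0) * word_ratio v))) ^ P
    \<le> real (k + 1) ^ n * (2 * (2 powr (\<epsilon> * real N) * (C * (2 powr (- \<delta> * real N) + 2 * (h * (hi - lo))) powr \<sigma>)) * (K * T powr \<epsilon>))"
proof -
  let ?W = "stop_words h k" and ?\<xi> = "\<lambda>v. 2 * pi * l * G (word_map v x0) * word_ratio v"
  let ?B = "2 powr (\<epsilon> * real N) * (C * (2 powr (- \<delta> * real N) + 2 * (h * (hi - lo))) powr \<sigma>)"
  have B: "0 \<le> ?B" using frost(2) by simp
  \<comment> \<open>The empty set in \<open>flat\<close> yields the sign.\<close>
  have K: "0 \<le> K * T powr \<epsilon>" using flat[OF T(1), of "{}"] by (simp add: separated_def)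
  have "(\<Sum>v\<in>?W. word_prob v * norm (char \<mu> (?\<xi> v))) ^ P \<le> (\<Sum>v\<in>?W. word_prob v * norm (char \<mu> (?\<xi> v)) ^ P)"
    by (intro jensen_power) (auto simp: sum_word_prob word_prob_nonneg[OF stop_words_subset])
  also have "\<dots> = (\<Sum>\<rho>\<in>word_ratio ` ?W. \<Sum>v\<in>{v\<in>?W. word_ratio v = \<rho>}. word_prob v * norm (char \<mu> (?\<xi> v)) ^ P)"
    by (intro sum.group[symmetric]) auto
  also have "\<dots> \<le> (\<Sum>\<rho>\<in>word_ratio ` ?W. 2 * ?B * (K * T powr \<epsilon>))"
  proof (intro sum_mono cell_sum_le[where s = s and \<Phi> = "\<lambda>x. norm (char \<mu> x) ^ P"])
    fix \<rho> Z assume Z: "Z \<subseteq> ?\<xi> ` {v\<in>?W. word_ratio v = \<rho>}" "separated s Z"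
    have "Z \<subseteq> {-T..T}"
    proof
      fix z assume "z \<in> Z"
      then obtain v where "v \<in> ?W" "z = ?\<xi> v" using Z by auto
      then have "\<bar>z\<bar> \<le> T" using T(2) by blast
      then show "z \<in> {-T..T}" by auto
    qed
    moreover have "finite Z" using Z(1) by (rule finite_subset) simp
    ultimately show "(\<Sum>x\<in>Z. norm (char \<mu> x) ^ P) \<le> K * T powr \<epsilon>" using Z T(1) by (intro flat)
  qed (use s B cell_mass_le[OF frost x0 h l s nf small] word_prob_nonneg[OF stop_words_subset] in auto)
  also have "\<dots> = real (card (word_ratio ` ?W)) * (2 * ?B * (K * T powr \<epsilon>))" by simp
  also have "\<dots> \<le> real ((k + 1) ^ n) * (2 * ?B * (K * T powr \<epsilon>))"
  proof (intro mult_right_mono of_nat_mono card_word_ratio)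
    have "0 \<le> 2 * ?B" using B by simp
    then show "0 \<le> 2 * ?B * (K * T powr \<epsilon>)" using K by (rule mult_nonneg_nonneg)
  qed
  finally show ?thesis by simp
qed

lemma norm_integral_le_1: "norm (LINT x:J|\<mu>. iexp (h x)) \<le> 1"
proof (cases "integrable \<mu> (\<lambda>x. indicator J x *\<^sub>R iexp (h x))")
  case True
  have "norm (LINT x:J|\<mu>. iexp (h x)) \<le> (\<integral>x. norm (indicator J x *\<^sub>R iexp (h x)) \<partial>\<mu>)"
    unfolding set_lebesgue_integral_def by (rule integral_norm_bound)
  also have "\<dots> \<le> (\<integral>x. 1 \<partial>\<mu>)" using integrable_norm[OF True] by (intro integral_mono) (auto simp: indicator_def)
  finally show ?thesis using prob_space by simp
\<comment> \<open>Without integrability the integral is 0 by convention.\<close>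
qed (simp add: set_lebesgue_integral_def not_integrable_integral_eq)

section \<open>Choice of scales and the final estimate\<close>

lemma stopping_length:
  assumes "0 < \<kappa>" "0 < \<eta>" "1 \<le> l"
  obtains k where "rmax ^ k < l powr - \<kappa>" "real (k + 1) \<le> (\<kappa> / (ln (1 / rmax) * \<eta>) + 3) * l powr \<eta>"
proof
  define z where "z = log rmax (l powr - \<kappa>)"
  \<comment> \<open>The extra 1 makes the inequality \<open>rmax ^ k < l powr - \<kappa>\<close>
    strict.\<close>
  define k where "k = nat \<lceil>z\<rceil> + 1"
  have lam: "0 < ln (1 / rmax)" using rmax_pos rmax_less_1 by simp
  have z: "z = \<kappa> * ln l / ln (1 / rmax)"
    using assms rmax_pos by (simp add: z_def log_def ln_powr ln_div)
  have z0: "0 \<le> z" unfolding z using assms lam by (intro divide_nonneg_pos mult_nonneg_nonneg) auto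
  have k: "z < real k" "real k + 1 \<le> z + 3" unfolding k_def using z0 by linarith+
  have "rmax ^ k = rmax powr real k" using rmax_pos by (simp add: powr_realpow)
  also have "\<dots> < rmax powr z" using k rmax_pos rmax_less_1 by (intro powr_less_mono') auto
  also have "\<dots> = l powr - \<kappa>" unfolding z_def using rmax_pos rmax_less_1 assms by simp
  finally show "rmax ^ k < l powr - \<kappa>" .
  \<comment> \<open>\<open>k\<close> is of order \<open>ln l\<close>, and a logarithm is bounded by
    any small power; this makes the number of ratios harmless.\<close>
  have "ln l \<le> l powr \<eta> / \<eta>" using assms by (intro ln_powr_bound) auto
  then have "z \<le> \<kappa> * (l powr \<eta> / \<eta>) / ln (1 / rmax)"
    unfolding z using assms lam by (intro divide_right_mono mult_left_mono) auto
  moreover have "1 \<le> l powr \<eta>" using assms by (intro ge_one_powr_ge_zero) auto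
  ultimately show "real (k + 1) \<le> (\<kappa> / (ln (1 / rmax) * \<eta>) + 3) * l powr \<eta>"
    using k by (simp add: algebra_simps)
qed

lemma dyadic_scale:
  fixes z :: real
  assumes "2 powr (real n0 + 2) \<le> z"
  obtains N :: nat where "n0 < N" "2 powr real N < z" "z \<le> 2 * 2 powr real N"
proof
  \<comment> \<open>Ceiling minus 1 gives the strict inequality \<open>2 powr real N < z\<close>;
    the margin 2 in the hypothesis still leaves \<open>n0 < N\<close>.\<close>
  define N where "N = nat (\<lceil>log 2 z\<rceil> - 1)"
  have z: "0 < z" using assms by (smt (verit) powr_gt_zero)
  have "real n0 + 2 \<le> log 2 z" using assms z by (simp add: le_log_iff)
  then show "n0 < N" unfolding N_def by linarith
  have N: "real N < log 2 z" "log 2 z \<le> real N + 1"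
    using \<open>real n0 + 2 \<le> log 2 z\<close> unfolding N_def by linarith+
  show "2 powr real N < z" using N(1) z by (simp add: less_log_iff)
  have "z \<le> 2 powr (real N + 1)" using N(2) z by (simp add: log_le_iff)
  then show "z \<le> 2 * 2 powr real N" by (simp add: powr_add)
qed

text \<open>\<open>\<tau>\<close> is fixed before \<open>J\<close> and \<open>g\<close>: it is built
  from the Frostman exponent, the flattening power, \<open>\<alpha>\<close> and
  \<open>\<delta>\<close>. Data of \<open>g\<close>, such as \<open>L\<close>, \<open>n0\<close> and
  the bound \<open>\<Gamma>\<close> on the derivative, enter only the constant.\<close>

lemma fourier_decay:
  assumes \<alpha>: "0 < \<alpha>" and \<delta>: "0 < \<delta>" "\<delta> \<le> 1"
  shows "\<exists>\<tau>>0. \<forall>J. is_interval J \<and> closed J \<and> (AE x in \<mu>. x \<in> J) \<longrightarrow>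
    (\<forall>g \<in> C1_holder \<alpha> J. non_flat \<delta> (deriv_within J g) J \<longrightarrow>
      (\<exists>C>0. \<forall>l>0. norm (LINT x:J|\<mu>. iexp (2 * pi * l * g x)) \<le> C * l powr (- \<tau>)))"
proof -
  obtain CF \<sigma> where CF: "0 < CF" and \<sigma>: "0 < \<sigma>"
    and frost: "\<And>u v l. v - u \<le> l \<Longrightarrow> 0 < l \<Longrightarrow> prob {u..v} \<le> CF * l powr \<sigma>"
    using frostman by blast
  \<comment> \<open>Three factors \<open>l powr (\<gamma> * \<epsilon>)\<close> will arise, from the
    ratios, the covering number and flattening. With the quarter, the Frostman factor
    \<open>l powr (- \<gamma> * \<delta> * \<sigma>)\<close> beats all three with one to
    spare.\<close>
  define \<epsilon> where "\<epsilon> = \<delta> * \<sigma> / 4"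
  have \<epsilon>: "0 < \<epsilon>" using \<delta> \<sigma> by (simp add: \<epsilon>_def)
  define s where "s = char.sep0"
  have s: "0 < s" unfolding s_def by (rule char.sep0_pos)
  obtain P :: nat and K where P: "1 \<le> P" and K: "0 < K"
    and flat: "\<And>T X. 1 \<le> T \<Longrightarrow> finite X \<Longrightarrow> separated s X \<Longrightarrow> X \<subseteq> {-T..T} \<Longrightarrow>
       (\<Sum>x\<in>X. norm (char \<mu> x) ^ P) \<le> K * T powr \<epsilon>"
    using char.flattening[OF \<epsilon>] unfolding s_def by blast
  \<comment> \<open>\<open>\<kappa>\<close> is the midpoint of \<open>1 / (1 + \<alpha>)\<close> and
    1. The phase error then has order \<open>l powr (1 - \<kappa> * (1 + \<alpha>))\<close>, that is
    \<open>l powr (- (\<alpha> / 2))\<close>, and the frequencies are at most of order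
    \<open>l powr \<gamma>\<close>.\<close>
  define \<kappa> \<gamma> where "\<kappa> = (2 + \<alpha>) / (2 * (1 + \<alpha>))" and "\<gamma> = \<alpha> / (2 * (1 + \<alpha>))"
  have \<kappa>\<gamma>: "0 < \<kappa>" "0 < \<gamma>" "\<kappa> = 1 - \<gamma>" "\<gamma> \<le> \<kappa>" "\<kappa> * (1 + \<alpha>) = 1 + \<alpha> / 2"
    using \<alpha> by (auto simp: \<kappa>_def \<gamma>_def field_simps)
  define \<tau> where "\<tau> = min (\<gamma> * \<epsilon> / P) (\<alpha> / 2)"
  have \<tau>: "0 < \<tau>" using \<kappa>\<gamma> \<epsilon> \<alpha> P by (simp add: \<tau>_def)
  have \<tau>_le: "\<tau> \<le> \<gamma> * \<epsilon> / P" "\<tau> \<le> \<alpha> / 2" unfolding \<tau>_def by (rule min.cobounded1, rule min.cobounded2)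
  \<comment> \<open>Chosen so that \<open>s / (2 * pi * l * (rmin * h))\<close> equals
    \<open>c / (l * h)\<close>.\<close>
  define c where "c = s / (2 * pi * rmin)"
  have c: "0 < c" using s rmin_pos by (simp add: c_def)
  define \<Delta> where "\<Delta> = hi - lo"
  have \<Delta>: "0 \<le> \<Delta>" using lo_le_hi by (simp add: \<Delta>_def)
  have npos: "0 < n" using ab by simp
  show ?thesis
  proof (rule exI[of _ \<tau>], intro conjI allI impI ballI, rule \<tau>)
    fix J g
    assume "is_interval J \<and> closed J \<and> (AE x in \<mu>. x \<in> J)"
    then have J: "is_interval J" "closed J" "AE x in \<mu>. x \<in> J" by auto
    assume g: "g \<in> C1_holder \<alpha> J" and nonflat: "non_flat \<delta> (deriv_within J g) J"
    define G where "G = deriv_within J g"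
    have diff: "g differentiable_on J" using g by (simp add: C1_holder_def)
    obtain L where L: "0 \<le> L" "\<And>x y. x \<in> J \<Longrightarrow> y \<in> J \<Longrightarrow> \<bar>G x - G y\<bar> \<le> L * \<bar>x - y\<bar> powr \<alpha>"
      using g holder_on_const[of \<alpha> J G] unfolding G_def C1_holder_def by blast
    have "J \<in> sets borel" using J(2) by simp
    then obtain x0 where x0: "x0 \<in> {lo..hi}" "\<And>v. set v \<subseteq> {..<n} \<Longrightarrow> word_map v x0 \<in> J"
      using ex_base_point[OF _ J(3)] by blast
    define \<Gamma> where "\<Gamma> = \<bar>G x0\<bar> + L * \<Delta> powr \<alpha>"
    have \<Gamma>0: "0 \<le> \<Gamma>" using L by (simp add: \<Gamma>_def)
    have \<Gamma>: "\<bar>G (word_map v x0)\<bar> \<le> \<Gamma>" if v: "set v \<subseteq> {..<n}" for v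
    proof -
      have "\<bar>G (word_map v x0) - G x0\<bar> \<le> L * \<bar>word_map v x0 - x0\<bar> powr \<alpha>"
        using x0(2)[OF v] x0(2)[of "[]"] by (intro L) auto
      also have "\<dots> \<le> L * \<Delta> powr \<alpha>"
        using word_map_lo_hi[OF v x0(1)] x0(1) L(1) \<alpha> by (intro mult_left_mono powr_mono2) (auto simp: \<Delta>_def)
      finally show ?thesis by (simp add: \<Gamma>_def)
    qed
    obtain n0 where nf: "\<And>m A. n0 < m \<Longrightarrow> bounded A \<Longrightarrow> A \<subseteq> J \<Longrightarrow>
        2 powr (\<epsilon> * real m) \<le> real (covering_number (2 powr (- \<delta> * real m)) A) \<Longrightarrow>
        bounded (G ` A) \<Longrightarrow> 2 powr (- real m) \<le> diameter (G ` A)"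
      using nonflat \<epsilon> unfolding non_flat_def G_def by meson
    \<comment> \<open>From \<open>l0\<close> on, \<open>l powr \<gamma> / c\<close> is at least
      \<open>2 powr (real n0 + 2)\<close>, so that the dyadic scale lies beyond
      \<open>n0\<close>.\<close>
    define l0 where "l0 = max 1 ((c * 2 powr (real n0 + 2)) powr (1 / \<gamma>))"
    define \<eta> where "\<eta> = \<gamma> * \<epsilon> / n"
    have \<eta>: "0 < \<eta>" using \<kappa>\<gamma> \<epsilon> npos by (simp add: \<eta>_def)
    define A1 where "A1 = \<kappa> / (ln (1 / rmax) * \<eta>) + 3"
    define A2 where "A2 = (2 * c) powr \<delta> + 2 * \<Delta>"
    define A3 where "A3 = 2 * pi * \<Gamma> + 1"
    define A where "A = A1 ^ n * (2 * ((1 / c) powr \<epsilon> * (CF * A2 powr \<sigma>)) * (K * A3 powr \<epsilon>))"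
    define E where "E = 2 * pi * L * \<Delta> powr (1 + \<alpha>)"
    have large: "norm (LINT x:J|\<mu>. iexp (2 * pi * l * g x)) \<le> (A powr (1 / P) + E) * l powr - \<tau>" if l: "l0 \<le> l" for l
    proof -
      have l1: "1 \<le> l" using l by (simp add: l0_def)
      define h where "h = l powr - \<kappa>"
      have h: "0 < h" "h \<le> 1" using l1 \<kappa>\<gamma> powr_mono[of "- \<kappa>" 0 l] by (auto simp: h_def)
      obtain k where k: "rmax ^ k < h" "real (k + 1) \<le> A1 * l powr \<eta>"
        using stopping_length[OF \<kappa>\<gamma>(1) \<eta> l1] unfolding h_def A1_def by blast
      \<comment> \<open>\<open>1 / z\<close> is the resolution at which a frequency cell of length
        \<open>s\<close> sees the derivative \<open>G\<close>.\<close>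
      define z where "z = l powr \<gamma> / c"
      have z: "0 < z" using l1 c by (simp add: z_def)
      have "2 powr (real n0 + 2) \<le> z"
      proof -
        have "c * 2 powr (real n0 + 2) = ((c * 2 powr (real n0 + 2)) powr (1 / \<gamma>)) powr \<gamma>"
          using c \<kappa>\<gamma> by (simp add: powr_powr)
        also have "\<dots> \<le> l powr \<gamma>" using l \<kappa>\<gamma> by (intro powr_mono2) (auto simp: l0_def)
        finally show ?thesis using c by (simp add: z_def field_simps)
      qed
      then obtain N where N: "n0 < N" "2 powr real N < z" "z \<le> 2 * 2 powr real N" by (rule dyadic_scale)
      \<comment> \<open>The frequencies are at most \<open>2 * pi * \<Gamma> * (l * h)\<close>; the
        summand 1 in \<open>A3\<close> ensures \<open>1 \<le> T\<close> even if
        \<open>\<Gamma>\<close> vanishes.\<close>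
      define T where "T = A3 * l powr \<gamma>"
      have lh: "l * h = l powr \<gamma>" using l1 \<kappa>\<gamma> by (simp add: h_def powr_mult_base)
      define S where "S = (\<Sum>v\<in>stop_words h k. word_prob v * norm (char \<mu> (2 * pi * l * G (word_map v x0) * word_ratio v)))"
      have "S ^ P \<le> real (k + 1) ^ n * (2 * (2 powr (\<epsilon> * real N) * (CF * (2 powr (- \<delta> * real N) + 2 * (h * (hi - lo))) powr \<sigma>)) * (K * T powr \<epsilon>))"
        unfolding S_def
      proof (rule power_sum_le[OF frost CF flat x0 k(1) h _ s])
        have "s / (2 * pi * l * (rmin * h)) = c / (l * h)" by (simp add: c_def mult_ac)
        also have "\<dots> = 1 / z" by (simp add: lh z_def)
        also have "\<dots> < 1 / 2 powr real N" using N z by (intro divide_strict_left_mono) auto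
        finally show "s / (2 * pi * l * (rmin * h)) < 2 powr - real N" by (simp add: powr_minus_divide)
        have "1 * 1 \<le> A3 * l powr \<gamma>" using \<Gamma>0 l1 \<kappa>\<gamma> unfolding A3_def
          by (intro mult_mono ge_one_powr_ge_zero) auto
        then show "1 \<le> T" by (simp add: T_def)
        show "\<bar>2 * pi * l * G (word_map v x0) * word_ratio v\<bar> \<le> T" if v: "v \<in> stop_words h k" for v
        proof -
          have "\<bar>2 * pi * l * G (word_map v x0) * word_ratio v\<bar> \<le> 2 * pi * l * \<Gamma> * h"
            unfolding abs_mult using l1 h \<Gamma>[OF stop_words_subset[OF v]] stop_words_ratio_less[OF k(1) v] \<Gamma>0
            by (intro mult_mono) auto
          also have "\<dots> = 2 * pi * \<Gamma> * (l * h)" by simp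
          also have "\<dots> \<le> T" unfolding lh T_def A3_def by (intro mult_right_mono) auto
          finally show ?thesis .
        qed
      qed (use l1 nf N(1) in auto)
      also have "\<dots> \<le> (A1 ^ n * l powr (\<gamma> * \<epsilon>)) *
          (2 * (((1 / c) powr \<epsilon> * l powr (\<gamma> * \<epsilon>)) * (CF * (A2 powr \<sigma> * l powr (- \<gamma> * \<delta> * \<sigma>)))) * (K * (A3 powr \<epsilon> * l powr (\<gamma> * \<epsilon>))))"
      proof (rule mult_mono)
        have "real (k + 1) ^ n \<le> (A1 * l powr \<eta>) ^ n" using k(2) by (intro power_mono) auto
        also have "\<dots> = A1 ^ n * l powr (\<gamma> * \<epsilon>)"
          using l1 npos by (simp add: power_mult_distrib powr_power \<eta>_def)
        finally show "real (k + 1) ^ n \<le> A1 ^ n * l powr (\<gamma> * \<epsilon>)" .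
        have b1: "2 powr (\<epsilon> * real N) \<le> (1 / c) powr \<epsilon> * l powr (\<gamma> * \<epsilon>)"
        proof -
          have "2 powr (\<epsilon> * real N) = (2 powr real N) powr \<epsilon>" by (simp add: powr_powr mult.commute)
          also have "\<dots> \<le> z powr \<epsilon>" using N \<epsilon> by (intro powr_mono2) auto
          also have "\<dots> = (1 / c) powr \<epsilon> * l powr (\<gamma> * \<epsilon>)"
            using c l1 by (simp add: z_def powr_divide powr_powr)
          finally show ?thesis .
        qed
        have b2: "2 powr (- \<delta> * real N) + 2 * (h * (hi - lo)) \<le> A2 * l powr (- \<gamma> * \<delta>)"
        proof -
          have "2 powr (- \<delta> * real N) = (1 / 2 powr real N) powr \<delta>"
            by (simp add: powr_divide powr_powr powr_minus_divide mult.commute)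
          also have "\<dots> \<le> (2 / z) powr \<delta>" using N z \<delta> by (intro powr_mono2) (auto simp: field_simps)
          also have "\<dots> = (2 * c) powr \<delta> * l powr (- \<gamma> * \<delta>)"
            using c l1 by (simp add: z_def powr_divide powr_powr powr_minus_divide powr_mult)
          finally have a: "2 powr (- \<delta> * real N) \<le> (2 * c) powr \<delta> * l powr (- \<gamma> * \<delta>)" .
          \<comment> \<open>The copy size is at most of the order
            \<open>l powr (- \<gamma> * \<delta>)\<close> of the covering balls, so enlarging the
            balls by it costs only a constant.\<close>
          have "\<gamma> * \<delta> \<le> \<kappa>" using \<kappa>\<gamma> \<delta> by (intro order_trans[OF mult_left_le]) auto
          then have "h \<le> l powr (- \<gamma> * \<delta>)" unfolding h_def using l1 by (intro powr_mono) auto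
          then have "h * \<Delta> \<le> l powr (- \<gamma> * \<delta>) * \<Delta>" using \<Delta> by (intro mult_right_mono)
          with a show ?thesis by (simp add: A2_def \<Delta>_def algebra_simps)
        qed
        have b3: "(2 powr (- \<delta> * real N) + 2 * (h * (hi - lo))) powr \<sigma> \<le> A2 powr \<sigma> * l powr (- \<gamma> * \<delta> * \<sigma>)"
        proof -
          have "(2 powr (- \<delta> * real N) + 2 * (h * (hi - lo))) powr \<sigma> \<le> (A2 * l powr (- \<gamma> * \<delta>)) powr \<sigma>"
            using b2 \<sigma> h lo_le_hi by (intro powr_mono2) (auto intro!: add_nonneg_nonneg)
          also have "\<dots> = A2 powr \<sigma> * l powr (- \<gamma> * \<delta> * \<sigma>)"
            using c \<Delta> by (simp add: A2_def powr_mult powr_powr)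
          finally show ?thesis .
        qed
        have b4: "T powr \<epsilon> = A3 powr \<epsilon> * l powr (\<gamma> * \<epsilon>)"
          using \<Gamma>0 by (simp add: T_def A3_def powr_mult powr_powr)
        show "2 * (2 powr (\<epsilon> * real N) * (CF * (2 powr (- \<delta> * real N) + 2 * (h * (hi - lo))) powr \<sigma>)) * (K * T powr \<epsilon>)
          \<le> 2 * (((1 / c) powr \<epsilon> * l powr (\<gamma> * \<epsilon>)) * (CF * (A2 powr \<sigma> * l powr (- \<gamma> * \<delta> * \<sigma>)))) * (K * (A3 powr \<epsilon> * l powr (\<gamma> * \<epsilon>)))"
          unfolding b4 using b1 b3 CF K by (intro mult_right_mono mult_left_mono mult_mono) auto
        show "0 \<le> A1 ^ n * l powr (\<gamma> * \<epsilon>)" using \<kappa>\<gamma> \<eta> rmax_pos rmax_less_1 by (simp add: A1_def)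
      qed (use CF K in auto)
      also have "\<dots> = A * l powr (- (\<gamma> * \<epsilon>))"
      proof -
        have "l powr (\<gamma> * \<epsilon>) * l powr (\<gamma> * \<epsilon>) * l powr (- \<gamma> * \<delta> * \<sigma>) * l powr (\<gamma> * \<epsilon>) = l powr (- (\<gamma> * \<epsilon>))"
          by (simp add: \<epsilon>_def algebra_simps flip: powr_add)
        then show ?thesis by (simp add: A_def mult_ac)
      qed
      finally have SP: "S ^ P \<le> A * l powr (- (\<gamma> * \<epsilon>))" .
      have S0: "0 \<le> S" unfolding S_def
        by (intro sum_nonneg mult_nonneg_nonneg word_prob_nonneg[OF stop_words_subset]) auto
      have A0: "0 \<le> A" using \<kappa>\<gamma> \<eta> rmax_pos rmax_less_1 CF K by (simp add: A_def A1_def)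
      have "S = (S ^ P) powr (1 / P)"
        using S0 P by (cases "S = 0") (auto simp: powr_powr simp flip: powr_realpow)
      also have "\<dots> \<le> (A * l powr (- (\<gamma> * \<epsilon>))) powr (1 / P)" using SP S0 by (intro powr_mono2) auto
      also have "\<dots> = A powr (1 / P) * l powr (- (\<gamma> * \<epsilon> / P))"
        using A0 by (simp add: powr_mult powr_powr)
      also have "\<dots> \<le> A powr (1 / P) * l powr - \<tau>"
        using l1 \<tau>_le by (intro mult_left_mono powr_mono) auto
      finally have S_le: "S \<le> A powr (1 / P) * l powr - \<tau>" .
      have "l * (h * \<Delta>) powr (1 + \<alpha>) = \<Delta> powr (1 + \<alpha>) * (l powr 1 * l powr (- (\<kappa> * (1 + \<alpha>))))"
        using l1 h \<Delta> by (simp add: powr_mult h_def powr_powr)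
      also have "l powr 1 * l powr (- (\<kappa> * (1 + \<alpha>))) = l powr (- (\<alpha> / 2))"
        unfolding \<kappa>\<gamma>(5) powr_add[symmetric] by simp
      also have "\<Delta> powr (1 + \<alpha>) * \<dots> \<le> \<Delta> powr (1 + \<alpha>) * l powr - \<tau>"
        using l1 \<tau>_le by (intro mult_left_mono powr_mono) auto
      finally have "2 * pi * L * (l * (h * \<Delta>) powr (1 + \<alpha>)) \<le> 2 * pi * L * (\<Delta> powr (1 + \<alpha>) * l powr - \<tau>)"
        using L(1) by (intro mult_left_mono) auto
      then have err: "2 * pi * l * L * (h * (hi - lo)) powr (1 + \<alpha>) \<le> E * l powr - \<tau>"
        by (simp add: E_def \<Delta>_def mult_ac)
      have "norm (LINT x:J|\<mu>. iexp (2 * pi * l * g x)) \<le> S + 2 * pi * l * L * (h * (hi - lo)) powr (1 + \<alpha>)"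
        unfolding S_def G_def
        using J diff \<alpha> L x0 k(1) l1 by (intro norm_integral_linearized) (auto simp: G_def)
      also have "\<dots> \<le> A powr (1 / P) * l powr - \<tau> + E * l powr - \<tau>" using S_le err by (rule add_mono)
      finally show ?thesis by (simp add: distrib_right)
    qed
    show "\<exists>C>0. \<forall>l>0. norm (LINT x:J|\<mu>. iexp (2 * pi * l * g x)) \<le> C * l powr - \<tau>"
    proof (intro exI conjI allI impI)
      have E0: "0 \<le> E" using L(1) by (simp add: E_def)
      have l00: "0 < l0 powr \<tau>" by (simp add: l0_def)
      \<comment> \<open>The last summand covers \<open>l < l0\<close>, where the trivial bound 1 is
        at most \<open>l0 powr \<tau> * l powr - \<tau>\<close>.\<close>
      show "0 < A powr (1 / P) + E + l0 powr \<tau>" using E0 l00 by (simp add: add_nonneg_pos)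
      fix l :: real assume l: "0 < l"
      show "norm (LINT x:J|\<mu>. iexp (2 * pi * l * g x)) \<le> (A powr (1 / P) + E + l0 powr \<tau>) * l powr - \<tau>"
      proof (cases "l0 \<le> l")
        case True
        have "norm (LINT x:J|\<mu>. iexp (2 * pi * l * g x)) \<le> (A powr (1 / P) + E) * l powr - \<tau>"
          using True by (rule large)
        also have "\<dots> \<le> (A powr (1 / P) + E + l0 powr \<tau>) * l powr - \<tau>"
          using l00 by (intro mult_right_mono) auto
        finally show ?thesis .
      next
        case False
        have "norm (LINT x:J|\<mu>. iexp (2 * pi * l * g x)) \<le> 1" by (rule norm_integral_le_1)
        also have "1 = l powr \<tau> * l powr - \<tau>" using l by (simp flip: powr_add)
        also have "\<dots> \<le> (A powr (1 / P) + E + l0 powr \<tau>) * l powr - \<tau>"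
        proof (rule mult_right_mono)
          have "l powr \<tau> \<le> l0 powr \<tau>" using False l \<tau> by (intro powr_mono2) auto
          then show "l powr \<tau> \<le> A powr (1 / P) + E + l0 powr \<tau>"
            using E0 powr_ge_zero[of A "1 / P"] by linarith
        qed simp
        finally show ?thesis .
      qed
    qed
  qed
qed

end

lemma self_similar_measureE:
  assumes "self_similar_measure \<mu>"
  obtains n r t p lo hi a b xa xb where "self_similar \<mu> n r t p lo hi a b xa xb"
proof -
  from assms obtain n r t p where ifs: "self_similar_ifs n r t"
    and rest: "prob_space \<mu>" "sets \<mu> = sets borel" "\<forall>i<n. p i > 0" "(\<Sum>i<n. p i) = 1"
      "\<forall>A\<in>sets borel. measure \<mu> A = (\<Sum>i<n. p i * measure (distr \<mu> borel (\<lambda>x. r i * x + t i)) A)"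
    unfolding self_similar_measure_def by blast
  obtain lo hi where K: "lo \<le> hi" "\<forall>i<n. (\<lambda>x. r i * x + t i) ` {lo..hi} \<subseteq> {lo..hi}"
    using ifs unfolding self_similar_ifs_def by blast
  obtain a b xa xb where fp: "a < n" "b < n" "r a * xa + t a = xa" "r b * xb + t b = xb" "xa \<noteq> xb"
    using ifs unfolding self_similar_ifs_def by blast
  have r: "\<forall>i<n. r i \<noteq> 0 \<and> \<bar>r i\<bar> < 1"
    using ifs unfolding self_similar_ifs_def by auto
  interpret prob_space \<mu> by (rule rest)
  have "self_similar \<mu> n r t p lo hi a b xa xb"
    by unfold_locales (use rest K fp r in \<open>auto simp: image_subset_iff\<close>)
  then show ?thesis by (rule that)
qed

theorem theorem1p6:
  fixes \<mu> :: "real measure" and \<alpha> \<delta> :: real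
  assumes "self_similar_measure \<mu>" and "non_atomic \<mu>"
    and "0 < \<alpha>" and "\<alpha> \<le> 1" and "0 < \<delta>" and "\<delta> \<le> 1"
  shows "\<exists>\<tau>>0. \<forall>J. is_interval J \<and> closed J \<and> (AE x in \<mu>. x \<in> J) \<longrightarrow>
           (\<forall>g \<in> C1_holder \<alpha> J. non_flat \<delta> (deriv_within J g) J \<longrightarrow>
              (\<exists>C>0. \<forall>l::real. l > 0 \<longrightarrow>
                 norm (LINT x:J|\<mu>. exp (2 * of_real pi * \<i> * of_real (g x) * of_real l) :: complex)
                   \<le> C * l powr (- \<tau>)))"
proof -
  obtain n r t p lo hi a b xa xb where "self_similar \<mu> n r t p lo hi a b xa xb"
    using self_similar_measureE[OF assms(1)] .
  then interpret self_similar \<mu> n r t p lo hi a b xa xb .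
  have "exp (2 * of_real pi * \<i> * of_real u * of_real l) = iexp (2 * pi * l * u)" for u l :: real
    by (simp add: mult_ac)
  then show ?thesis using fourier_decay[OF assms(3,5,6)] by simp
qed

end
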